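(* The principle $\overline{D}_2\mathsf{IP}$ is not provable in $\mathsf{WKL}_0$.
   Context: $\mathsf{RCA}_0$ is the subsystem of second-order arithmetic consisting of the axioms of a discrete ordered semiring, $\Sigma^0_1$ induction and $\Delta^0_1$ comprehension. $\mathsf{WKL}_0$ is $\mathsf{RCA}_0$ together with weak König's lemma: every infinite subtree of $2^{<\mathbb{N}}$ contains an infinite path. A family of sets is a sequence $A = \langle A_i : i \in \mathbb{N}\rangle$ of sets of natural numbers (coded as a single set); it is nontrivial if $A_i \neq \emptyset$ for some $i$. A family $B = \langle B_i : i\in\mathbb{N}\rangle$ is a subfamily of $A$ if $(\forall i)(\exists j)[B_i = A_j]$. Two members of a family are distinct if they differ extensionally as sets. A family has the $\overline{D}_2$ intersection property if the intersection of any two distinct sets in it is nonempty. $B$ is a maximal subfamily of $A$ with the $\overline{D}_2$ intersection property if $B$ is a subfamily of $A$ with this property, and for every subfamily $C$ of $A$ that also has this property, if $B$ is a subfamily of $C$ then $C$ is a subfamily of $B$. $\overline{D}_2\mathsf{IP}$ is the statement: every nontrivial family of sets has a maximal subfamily with the $\overline{D}_2$ intersection property. *)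

theory Defs
  imports Main
begin

section \<open>The language of second-order arithmetic\<close>

text \<open>Number variables and set variables are both named by strings, but they live in separate name
  spaces: the number variable and the set variable called \<open>''x''\<close> are unrelated. As usual, equality is
  primitive only between number terms; extensional equality of sets is written out.\<close>

datatype trm =
    Var string
  | Zero ("\<^bold>0")
  | One ("\<^bold>1")
  | Add trm trm (infixl "\<^bold>+" 75)
  | Mul trm trm (infixl "\<^bold>*" 80)

datatype fm =
    Eq trm trm (infix "\<^bold>=" 60)
  | Less trm trm (infix "\<^bold><" 60)
  | Mem trm string (infix "\<^bold>\<in>" 60)
  | Neg fm ("\<^bold>\<not> _" [55] 55)
  | Imp fm fm (infixr "\<^bold>\<longrightarrow>" 40)
  | AllN string fm ("(\<^bold>\<forall>_./ _)" [0, 30] 30)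
  | AllS string fm ("(\<^bold>\<forall>\<^bold>S _./ _)" [0, 30] 30)

abbreviation And (infixr "\<^bold>\<and>" 50) where "\<phi> \<^bold>\<and> \<psi> \<equiv> \<^bold>\<not> (\<phi> \<^bold>\<longrightarrow> \<^bold>\<not> \<psi>)"
abbreviation Or (infixr "\<^bold>\<or>" 45) where "\<phi> \<^bold>\<or> \<psi> \<equiv> \<^bold>\<not> \<phi> \<^bold>\<longrightarrow> \<psi>"
abbreviation Iff (infix "\<^bold>\<longleftrightarrow>" 38) where "\<phi> \<^bold>\<longleftrightarrow> \<psi> \<equiv> (\<phi> \<^bold>\<longrightarrow> \<psi>) \<^bold>\<and> (\<psi> \<^bold>\<longrightarrow> \<phi>)"
abbreviation ExN ("(\<^bold>\<exists>_./ _)" [0, 30] 30) where "\<^bold>\<exists>x. \<phi> \<equiv> \<^bold>\<not> (\<^bold>\<forall>x. \<^bold>\<not> \<phi>)"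
abbreviation ExS ("(\<^bold>\<exists>\<^bold>S _./ _)" [0, 30] 30) where "\<^bold>\<exists>\<^bold>S X. \<phi> \<equiv> \<^bold>\<not> (\<^bold>\<forall>\<^bold>S X. \<^bold>\<not> \<phi>)"

primrec vars :: "trm \<Rightarrow> string set" where
  "vars (Var x) = {x}"
| "vars \<^bold>0 = {}"
| "vars \<^bold>1 = {}"
| "vars (s \<^bold>+ t) = vars s \<union> vars t"
| "vars (s \<^bold>* t) = vars s \<union> vars t"

text \<open>Free number variables and free set variables.\<close>

primrec fvN :: "fm \<Rightarrow> string set" where
  "fvN (s \<^bold>= t) = vars s \<union> vars t"
| "fvN (s \<^bold>< t) = vars s \<union> vars t"
| "fvN (t \<^bold>\<in> X) = vars t"
| "fvN (\<^bold>\<not> \<phi>) = fvN \<phi>"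
| "fvN (\<phi> \<^bold>\<longrightarrow> \<psi>) = fvN \<phi> \<union> fvN \<psi>"
| "fvN (\<^bold>\<forall>x. \<phi>) = fvN \<phi> - {x}"
| "fvN (\<^bold>\<forall>\<^bold>S X. \<phi>) = fvN \<phi>"

primrec fvS :: "fm \<Rightarrow> string set" where
  "fvS (s \<^bold>= t) = {}"
| "fvS (s \<^bold>< t) = {}"
| "fvS (t \<^bold>\<in> X) = {X}"
| "fvS (\<^bold>\<not> \<phi>) = fvS \<phi>"
| "fvS (\<phi> \<^bold>\<longrightarrow> \<psi>) = fvS \<phi> \<union> fvS \<psi>"
| "fvS (\<^bold>\<forall>x. \<phi>) = fvS \<phi>"
| "fvS (\<^bold>\<forall>\<^bold>S X. \<phi>) = fvS \<phi> - {X}"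

text \<open>Substitution of a term for the free occurrences of a number variable, and of a set variable for
  the free occurrences of a set variable. Bound variables are not renamed; wherever capture could occur,
  the predicates \<open>free_forN\<close> and \<open>free_forS\<close> are imposed as side conditions.\<close>

primrec subst_trm :: "string \<Rightarrow> trm \<Rightarrow> trm \<Rightarrow> trm" where
  "subst_trm x t (Var y) = (if y = x then t else Var y)"
| "subst_trm x t \<^bold>0 = \<^bold>0"
| "subst_trm x t \<^bold>1 = \<^bold>1"
| "subst_trm x t (r \<^bold>+ s) = subst_trm x t r \<^bold>+ subst_trm x t s"
| "subst_trm x t (r \<^bold>* s) = subst_trm x t r \<^bold>* subst_trm x t s"

primrec substN :: "string \<Rightarrow> trm \<Rightarrow> fm \<Rightarrow> fm" where
  "substN x t (r \<^bold>= s) = (subst_trm x t r \<^bold>= subst_trm x t s)"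
| "substN x t (r \<^bold>< s) = (subst_trm x t r \<^bold>< subst_trm x t s)"
| "substN x t (r \<^bold>\<in> X) = (subst_trm x t r \<^bold>\<in> X)"
| "substN x t (\<^bold>\<not> \<phi>) = (\<^bold>\<not> substN x t \<phi>)"
| "substN x t (\<phi> \<^bold>\<longrightarrow> \<psi>) = (substN x t \<phi> \<^bold>\<longrightarrow> substN x t \<psi>)"
| "substN x t (\<^bold>\<forall>y. \<phi>) = (\<^bold>\<forall>y. (if y = x then \<phi> else substN x t \<phi>))"
| "substN x t (\<^bold>\<forall>\<^bold>S Y. \<phi>) = (\<^bold>\<forall>\<^bold>S Y. substN x t \<phi>)"

primrec substS :: "string \<Rightarrow> string \<Rightarrow> fm \<Rightarrow> fm" where
  "substS X Y (r \<^bold>= s) = (r \<^bold>= s)"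
| "substS X Y (r \<^bold>< s) = (r \<^bold>< s)"
| "substS X Y (r \<^bold>\<in> Z) = (r \<^bold>\<in> (if Z = X then Y else Z))"
| "substS X Y (\<^bold>\<not> \<phi>) = (\<^bold>\<not> substS X Y \<phi>)"
| "substS X Y (\<phi> \<^bold>\<longrightarrow> \<psi>) = (substS X Y \<phi> \<^bold>\<longrightarrow> substS X Y \<psi>)"
| "substS X Y (\<^bold>\<forall>y. \<phi>) = (\<^bold>\<forall>y. substS X Y \<phi>)"
| "substS X Y (\<^bold>\<forall>\<^bold>S Z. \<phi>) = (\<^bold>\<forall>\<^bold>S Z. (if Z = X then \<phi> else substS X Y \<phi>))"

primrec free_forN :: "trm \<Rightarrow> string \<Rightarrow> fm \<Rightarrow> bool" where
  "free_forN t x (r \<^bold>= s) \<longleftrightarrow> True"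
| "free_forN t x (r \<^bold>< s) \<longleftrightarrow> True"
| "free_forN t x (r \<^bold>\<in> X) \<longleftrightarrow> True"
| "free_forN t x (\<^bold>\<not> \<phi>) \<longleftrightarrow> free_forN t x \<phi>"
| "free_forN t x (\<phi> \<^bold>\<longrightarrow> \<psi>) \<longleftrightarrow> free_forN t x \<phi> \<and> free_forN t x \<psi>"
| "free_forN t x (\<^bold>\<forall>y. \<phi>) \<longleftrightarrow> (x \<in> fvN (\<^bold>\<forall>y. \<phi>) \<longrightarrow> y \<notin> vars t \<and> free_forN t x \<phi>)"
| "free_forN t x (\<^bold>\<forall>\<^bold>S Y. \<phi>) \<longleftrightarrow> free_forN t x \<phi>"

primrec free_forS :: "string \<Rightarrow> string \<Rightarrow> fm \<Rightarrow> bool" where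
  "free_forS Y X (r \<^bold>= s) \<longleftrightarrow> True"
| "free_forS Y X (r \<^bold>< s) \<longleftrightarrow> True"
| "free_forS Y X (r \<^bold>\<in> Z) \<longleftrightarrow> True"
| "free_forS Y X (\<^bold>\<not> \<phi>) \<longleftrightarrow> free_forS Y X \<phi>"
| "free_forS Y X (\<phi> \<^bold>\<longrightarrow> \<psi>) \<longleftrightarrow> free_forS Y X \<phi> \<and> free_forS Y X \<psi>"
| "free_forS Y X (\<^bold>\<forall>y. \<phi>) \<longleftrightarrow> free_forS Y X \<phi>"
| "free_forS Y X (\<^bold>\<forall>\<^bold>S Z. \<phi>) \<longleftrightarrow> (X \<in> fvS (\<^bold>\<forall>\<^bold>S Z. \<phi>) \<longrightarrow> Z \<noteq> Y \<and> free_forS Y X \<phi>)"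

section \<open>Provability\<close>

text \<open>A Hilbert calculus in the style of Mendelson for two-sorted classical first-order logic with
  equality. Generalization is unrestricted, so an open formula in the set \<open>T\<close> of nonlogical axioms counts
  as its universal closure.\<close>

inductive provable :: "fm set \<Rightarrow> fm \<Rightarrow> bool" (infix "\<turnstile>" 25) for T :: "fm set" where
  Axiom: "\<phi> \<in> T \<Longrightarrow> T \<turnstile> \<phi>"
| MP: "T \<turnstile> \<phi> \<^bold>\<longrightarrow> \<psi> \<Longrightarrow> T \<turnstile> \<phi> \<Longrightarrow> T \<turnstile> \<psi>"
| GenN: "T \<turnstile> \<phi> \<Longrightarrow> T \<turnstile> \<^bold>\<forall>x. \<phi>"
| GenS: "T \<turnstile> \<phi> \<Longrightarrow> T \<turnstile> \<^bold>\<forall>\<^bold>S X. \<phi>"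
| K: "T \<turnstile> \<phi> \<^bold>\<longrightarrow> \<psi> \<^bold>\<longrightarrow> \<phi>"
| S: "T \<turnstile> (\<phi> \<^bold>\<longrightarrow> \<psi> \<^bold>\<longrightarrow> \<chi>) \<^bold>\<longrightarrow> (\<phi> \<^bold>\<longrightarrow> \<psi>) \<^bold>\<longrightarrow> \<phi> \<^bold>\<longrightarrow> \<chi>"
| Contrapos: "T \<turnstile> (\<^bold>\<not> \<phi> \<^bold>\<longrightarrow> \<^bold>\<not> \<psi>) \<^bold>\<longrightarrow> \<psi> \<^bold>\<longrightarrow> \<phi>"
| InstN: "free_forN t x \<phi> \<Longrightarrow> T \<turnstile> (\<^bold>\<forall>x. \<phi>) \<^bold>\<longrightarrow> substN x t \<phi>"
| InstS: "free_forS Y X \<phi> \<Longrightarrow> T \<turnstile> (\<^bold>\<forall>\<^bold>S X. \<phi>) \<^bold>\<longrightarrow> substS X Y \<phi>"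
| DistN: "x \<notin> fvN \<phi> \<Longrightarrow> T \<turnstile> (\<^bold>\<forall>x. \<phi> \<^bold>\<longrightarrow> \<psi>) \<^bold>\<longrightarrow> \<phi> \<^bold>\<longrightarrow> (\<^bold>\<forall>x. \<psi>)"
| DistS: "X \<notin> fvS \<phi> \<Longrightarrow> T \<turnstile> (\<^bold>\<forall>\<^bold>S X. \<phi> \<^bold>\<longrightarrow> \<psi>) \<^bold>\<longrightarrow> \<phi> \<^bold>\<longrightarrow> (\<^bold>\<forall>\<^bold>S X. \<psi>)"
| Refl: "T \<turnstile> t \<^bold>= t"
| Leibniz: "free_forN s x \<phi> \<Longrightarrow> free_forN t x \<phi> \<Longrightarrow>
    T \<turnstile> s \<^bold>= t \<^bold>\<longrightarrow> substN x s \<phi> \<^bold>\<longrightarrow> substN x t \<phi>"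

section \<open>The axioms of \<open>RCA\<^sub>0\<close>\<close>

text \<open>The axioms of (the nonnegative part of) a discretely ordered ring, also known as PA minus
  induction, stated as open formulas.\<close>

definition semiring_axioms :: "fm set" where
  "semiring_axioms = (let x = Var ''x''; y = Var ''y''; z = Var ''z'' in
    { (x \<^bold>+ y) \<^bold>+ z \<^bold>= x \<^bold>+ (y \<^bold>+ z),
      x \<^bold>+ y \<^bold>= y \<^bold>+ x,
      (x \<^bold>* y) \<^bold>* z \<^bold>= x \<^bold>* (y \<^bold>* z),
      x \<^bold>* y \<^bold>= y \<^bold>* x,
      x \<^bold>* (y \<^bold>+ z) \<^bold>= x \<^bold>* y \<^bold>+ x \<^bold>* z,
      x \<^bold>+ \<^bold>0 \<^bold>= x,
      x \<^bold>* \<^bold>0 \<^bold>= \<^bold>0,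
      x \<^bold>* \<^bold>1 \<^bold>= x,
      \<^bold>\<not> x \<^bold>< x,
      x \<^bold>< y \<^bold>\<and> y \<^bold>< z \<^bold>\<longrightarrow> x \<^bold>< z,
      x \<^bold>< y \<^bold>\<or> x \<^bold>= y \<^bold>\<or> y \<^bold>< x,
      x \<^bold>< y \<^bold>\<longrightarrow> x \<^bold>+ z \<^bold>< y \<^bold>+ z,
      \<^bold>0 \<^bold>< z \<^bold>\<and> x \<^bold>< y \<^bold>\<longrightarrow> x \<^bold>* z \<^bold>< y \<^bold>* z,
      x \<^bold>< y \<^bold>\<longrightarrow> (\<^bold>\<exists>''z''. x \<^bold>+ z \<^bold>= y),
      \<^bold>0 \<^bold>= x \<^bold>\<or> \<^bold>0 \<^bold>< x,
      \<^bold>0 \<^bold>< \<^bold>1,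
      \<^bold>0 \<^bold>< x \<^bold>\<longrightarrow> \<^bold>1 \<^bold>= x \<^bold>\<or> \<^bold>1 \<^bold>< x })"

text \<open>Formulas with only bounded number quantifiers and no set quantifiers; free set variables
  are allowed as parameters.\<close>

inductive_set Delta0 :: "fm set" where
  "(s \<^bold>= t) \<in> Delta0"
| "(s \<^bold>< t) \<in> Delta0"
| "(t \<^bold>\<in> X) \<in> Delta0"
| "\<phi> \<in> Delta0 \<Longrightarrow> (\<^bold>\<not> \<phi>) \<in> Delta0"
| "\<phi> \<in> Delta0 \<Longrightarrow> \<psi> \<in> Delta0 \<Longrightarrow> (\<phi> \<^bold>\<longrightarrow> \<psi>) \<in> Delta0"
| "\<phi> \<in> Delta0 \<Longrightarrow> x \<notin> vars t \<Longrightarrow> (\<^bold>\<forall>x. Var x \<^bold>< t \<^bold>\<longrightarrow> \<phi>) \<in> Delta0"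
| "\<phi> \<in> Delta0 \<Longrightarrow> x \<notin> vars t \<Longrightarrow> (\<^bold>\<exists>x. Var x \<^bold>< t \<^bold>\<and> \<phi>) \<in> Delta0"

definition Sigma01 :: "fm set" where
  "Sigma01 = {\<^bold>\<exists>x. \<phi> | x \<phi>. \<phi> \<in> Delta0}"

definition Pi01 :: "fm set" where
  "Pi01 = {\<^bold>\<forall>x. \<phi> | x \<phi>. \<phi> \<in> Delta0}"

text \<open>No side condition is needed: \<open>\<^bold>0\<close> and \<open>n + 1\<close> are always free for \<open>n\<close>.\<close>

definition Sigma01_induction :: "fm set" where
  "Sigma01_induction =
    {substN n \<^bold>0 \<phi> \<^bold>\<and> (\<^bold>\<forall>n. \<phi> \<^bold>\<longrightarrow> substN n (Var n \<^bold>+ \<^bold>1) \<phi>) \<^bold>\<longrightarrow> (\<^bold>\<forall>n. \<phi>) | n \<phi>. \<phi> \<in> Sigma01}"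

definition Delta01_comprehension :: "fm set" where
  "Delta01_comprehension =
    {(\<^bold>\<forall>n. \<phi> \<^bold>\<longleftrightarrow> \<psi>) \<^bold>\<longrightarrow> (\<^bold>\<exists>\<^bold>S X. \<^bold>\<forall>n. Var n \<^bold>\<in> X \<^bold>\<longleftrightarrow> \<phi>) | n X \<phi> \<psi>.
      \<phi> \<in> Sigma01 \<and> \<psi> \<in> Pi01 \<and> X \<notin> fvS \<phi>}"

definition RCA0 :: "fm set" where
  "RCA0 = semiring_axioms \<union> Sigma01_induction \<union> Delta01_comprehension"

section \<open>Weak Koenig's lemma\<close>

text \<open>The coding follows Simpson, Subsystems of Second Order Arithmetic, Section II.2.
  The pair of \<open>i\<close> and \<open>j\<close> is \<open>(i + j)\<^sup>2 + i\<close>.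
  A triple \<open>c = (k, (m, n))\<close> represents the finite set of those \<open>i < k\<close> for which \<open>m (i + 1) + 1\<close>
  divides \<open>n\<close>, and the code of a finite set is the least triple representing it.
  A finite sequence is (the code of) its graph.

  The formula abbreviations below bind fixed variable names, so the terms they are applied to must avoid
  these: \<open>d, k, m, n\<close> for \<open>is_triple\<close> and \<open>fin_mem\<close>, and all of \<open>c, d, i, j, k, m, n, u, v, w\<close> for those
  after them.\<close>

definition pair :: "trm \<Rightarrow> trm \<Rightarrow> trm" where
  "pair s t = (s \<^bold>+ t) \<^bold>* (s \<^bold>+ t) \<^bold>+ s"

definition is_triple :: "trm \<Rightarrow> fm" where
  "is_triple c = (\<^bold>\<exists>''k''. \<^bold>\<exists>''m''. \<^bold>\<exists>''n''. c \<^bold>= pair (Var ''k'') (pair (Var ''m'') (Var ''n'')))"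

definition fin_mem :: "trm \<Rightarrow> trm \<Rightarrow> fm" where
  "fin_mem i c = (let k = Var ''k''; m = Var ''m''; n = Var ''n'' in
    \<^bold>\<exists>''k''. \<^bold>\<exists>''m''. \<^bold>\<exists>''n''. c \<^bold>= pair k (pair m n) \<^bold>\<and> i \<^bold>< k \<^bold>\<and>
      (\<^bold>\<exists>''d''. (m \<^bold>* (i \<^bold>+ \<^bold>1) \<^bold>+ \<^bold>1) \<^bold>* Var ''d'' \<^bold>= n))"

definition fin_code :: "trm \<Rightarrow> fm" where
  "fin_code s = (let c = Var ''c''; i = Var ''i'' in
    is_triple s \<^bold>\<and>
    (\<^bold>\<forall>''c''. c \<^bold>< s \<^bold>\<and> is_triple c \<^bold>\<longrightarrow> \<^bold>\<not> (\<^bold>\<forall>''i''. fin_mem i c \<^bold>\<longleftrightarrow> fin_mem i s)))"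

text \<open>\<open>s\<close> is a finite sequence of length \<open>l\<close>.\<close>

definition seq_of_length :: "trm \<Rightarrow> trm \<Rightarrow> fm" where
  "seq_of_length s l = (let i = Var ''i''; j = Var ''j''; u = Var ''u''; v = Var ''v'' in
    fin_code s \<^bold>\<and>
    (\<^bold>\<forall>''i''. fin_mem i s \<^bold>\<longrightarrow> (\<^bold>\<exists>''j''. \<^bold>\<exists>''v''. j \<^bold>< l \<^bold>\<and> i \<^bold>= pair j v)) \<^bold>\<and>
    (\<^bold>\<forall>''j''. j \<^bold>< l \<^bold>\<longrightarrow>
      (\<^bold>\<exists>''v''. fin_mem (pair j v) s \<^bold>\<and> (\<^bold>\<forall>''u''. fin_mem (pair j u) s \<^bold>\<longrightarrow> u \<^bold>= v))))"

definition binary_string :: "trm \<Rightarrow> fm" where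
  "binary_string s = (let j = Var ''j''; v = Var ''v''; w = Var ''w'' in
    (\<^bold>\<exists>''w''. seq_of_length s w) \<^bold>\<and>
    (\<^bold>\<forall>''j''. \<^bold>\<forall>''v''. fin_mem (pair j v) s \<^bold>\<longrightarrow> v \<^bold>= \<^bold>0 \<^bold>\<or> v \<^bold>= \<^bold>1))"

definition initial_segment :: "trm \<Rightarrow> trm \<Rightarrow> fm" where
  "initial_segment s t = (\<^bold>\<forall>''i''. fin_mem (Var ''i'') s \<^bold>\<longrightarrow> fin_mem (Var ''i'') t)"

definition binary_tree :: "string \<Rightarrow> fm" where
  "binary_tree T = (let s = Var ''s''; t = Var ''t'' in
    (\<^bold>\<forall>''s''. s \<^bold>\<in> T \<^bold>\<longrightarrow> binary_string s) \<^bold>\<and>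
    (\<^bold>\<forall>''s''. \<^bold>\<forall>''t''. binary_string s \<^bold>\<and> t \<^bold>\<in> T \<^bold>\<and> initial_segment s t \<^bold>\<longrightarrow> s \<^bold>\<in> T))"

definition infinite_set :: "string \<Rightarrow> fm" where
  "infinite_set X = (\<^bold>\<forall>''x''. \<^bold>\<exists>''y''. Var ''x'' \<^bold>< Var ''y'' \<^bold>\<and> Var ''y'' \<^bold>\<in> X)"

text \<open>\<open>F\<close> is (the graph of) a function from \<open>\<nat>\<close> to \<open>{0, 1}\<close>.\<close>

definition binary_function :: "string \<Rightarrow> fm" where
  "binary_function F = (let i = Var ''i''; j = Var ''j''; u = Var ''u''; v = Var ''v'' in
    (\<^bold>\<forall>''i''. i \<^bold>\<in> F \<^bold>\<longrightarrow> (\<^bold>\<exists>''j''. \<^bold>\<exists>''v''. i \<^bold>= pair j v \<^bold>\<and> (v \<^bold>= \<^bold>0 \<^bold>\<or> v \<^bold>= \<^bold>1))) \<^bold>\<and>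
    (\<^bold>\<forall>''j''. \<^bold>\<exists>''v''. pair j v \<^bold>\<in> F \<^bold>\<and> (\<^bold>\<forall>''u''. pair j u \<^bold>\<in> F \<^bold>\<longrightarrow> u \<^bold>= v)))"

text \<open>All the finite restrictions of \<open>F\<close> to \<open>{0, \<dots>, l - 1}\<close> belong to \<open>T\<close>.\<close>

definition path_of :: "string \<Rightarrow> string \<Rightarrow> fm" where
  "path_of F T = (let s = Var ''s''; l = Var ''l''; j = Var ''j''; v = Var ''v'' in
    binary_function F \<^bold>\<and>
    (\<^bold>\<forall>''l''. \<^bold>\<exists>''s''. s \<^bold>\<in> T \<^bold>\<and> seq_of_length s l \<^bold>\<and>
      (\<^bold>\<forall>''j''. \<^bold>\<forall>''v''. fin_mem (pair j v) s \<^bold>\<longrightarrow> pair j v \<^bold>\<in> F)))"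

definition WKL :: fm where
  "WKL = (\<^bold>\<forall>\<^bold>S ''T''. binary_tree ''T'' \<^bold>\<and> infinite_set ''T'' \<^bold>\<longrightarrow> (\<^bold>\<exists>\<^bold>S ''F''. path_of ''F'' ''T''))"

definition WKL0 :: "fm set" where
  "WKL0 = insert WKL RCA0"

section \<open>The intersection principle\<close>

text \<open>A family is coded by a single set \<open>A\<close>, its \<open>i\<close>-th member being the column
  \<open>{x. pair i x \<in> A}\<close>; thus every set codes a family. \<open>column x A i\<close> says that
  \<open>x\<close> is an element of the \<open>i\<close>-th member of \<open>A\<close>.\<close>

definition column :: "trm \<Rightarrow> string \<Rightarrow> trm \<Rightarrow> fm" where
  "column x A i = (pair i x \<^bold>\<in> A)"

definition nontrivial_family :: "string \<Rightarrow> fm" where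
  "nontrivial_family A = (\<^bold>\<exists>''i''. \<^bold>\<exists>''x''. column (Var ''x'') A (Var ''i''))"

definition subfamily :: "string \<Rightarrow> string \<Rightarrow> fm" where
  "subfamily B A = (let i = Var ''i''; j = Var ''j''; x = Var ''x'' in
    \<^bold>\<forall>''i''. \<^bold>\<exists>''j''. \<^bold>\<forall>''x''. column x B i \<^bold>\<longleftrightarrow> column x A j)"

definition D2_intersection :: "string \<Rightarrow> fm" where
  "D2_intersection B = (let i = Var ''i''; j = Var ''j''; x = Var ''x'' in
    \<^bold>\<forall>''i''. \<^bold>\<forall>''j''. \<^bold>\<not> (\<^bold>\<forall>''x''. column x B i \<^bold>\<longleftrightarrow> column x B j) \<^bold>\<longrightarrow>
      (\<^bold>\<exists>''x''. column x B i \<^bold>\<and> column x B j))"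

definition D2IP :: fm where
  "D2IP = (\<^bold>\<forall>\<^bold>S ''A''. nontrivial_family ''A'' \<^bold>\<longrightarrow>
    (\<^bold>\<exists>\<^bold>S ''B''. subfamily ''B'' ''A'' \<^bold>\<and> D2_intersection ''B'' \<^bold>\<and>
      (\<^bold>\<forall>\<^bold>S ''C''. subfamily ''C'' ''A'' \<^bold>\<and> D2_intersection ''C'' \<^bold>\<and> subfamily ''B'' ''C'' \<^bold>\<longrightarrow>
        subfamily ''C'' ''B'')))"

end

theory Submission
  imports Defs "HOL-Library.Countable_Set" "HOL-Library.Sublist"
begin

text \<open>Provability is sound for omega-models, so it suffices to find a collection \<open>M\<close> of sets of numbers
  that satisfies \<open>WKL\<^sub>0\<close> and contains a family without a maximal subfamily in \<open>M\<close>. The collection is chosen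
  small: every function computable from one of its sets is dominated by a computable function. The
  family is computable and has the opposite property: whatever enumerates one of its maximal
  subfamilies computes a function that no computable function dominates.

  \<^bold>\<open>Computability.\<close> Computations are relativized to a countable supply of arbitrary functions, which does
  no harm because only the existence of \<open>M\<close> matters. A program is an instruction that is consulted at
  every stage \<open>n\<close>; it sees the oracle below \<open>n\<close> and the results that all programs, with all oracles, have
  reached by stage \<open>n\<close>, and may answer by any function of these data. Universal step-bounded
  evaluation is thus built in, and the six families of instructions (the definitions ending in \<open>op\<close>) are
  the only programs ever written. What remains of recursion theory is the use principle (\<open>ev_use\<close>) and
  universality.

  \<^bold>\<open>The model.\<close> \<open>M\<close> consists of the sets computable from finitely many columns of a single set \<open>X\<close>. The
  condition \<open>scott\<close>, which is of the form "at every stage \<open>n\<close>, the part of \<open>X\<close> below \<open>n\<close> looks right", makes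
  column \<open>m\<close> of \<open>X\<close> contain a path through every infinite binary tree computable from the columns before
  \<open>m\<close>; this gives weak Koenig's lemma in \<open>M\<close> (\<open>valid_WKL_sets_of\<close>). The sets with this property form an
  effectively closed class, and by the hyperimmune-free basis theorem (\<open>hyperimmune_free_basis\<close>) it has a
  member \<open>X\<close> all of whose computable functions are dominated by oracle-free ones. Comprehension holds since
  the truth of a bounded formula depends on finitely much of its set parameters (\<open>valid_comprehension\<close>).

  \<^bold>\<open>The family.\<close> The members \<open>A\<^sub>a\<close> are indexed by the nodes \<open>a\<close> of a graph whose edges are enumerated by stages:
  \<open>A\<^sub>a\<close> contains the private element \<open>2a\<close> and one element for every edge at \<open>a\<close>, so that maximal subfamilies
  are maximal cliques (\<open>clique_of_maximal_subfamily\<close>). There are nodes for strings of numbers; two of these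
  are joined iff they are comparable, so the strings in a clique lie on a path. In addition, as soon as
  the program \<open>e\<close> has converged on all numbers up to the weight of a string \<open>v\<close>, and that
  weight is at least \<open>e\<close>, there is a witness node for \<open>e\<close> and \<open>v\<close>. It is joined to everything compatible with \<open>v\<close>, but to a proper extension \<open>u\<close> of \<open>v\<close> only
  after the program \<open>e\<close> has converged on all numbers up to the weight of \<open>u\<close>, unless some step between
  \<open>v\<close> and \<open>u\<close> leads to a string heavier than the time the program took at the previous string.

  If the program \<open>e\<close> diverges somewhere, this exception allows a clique to be extended by a sufficiently
  heavy step; hence a maximal clique contains arbitrarily long strings (\<open>clique_extends\<close>). Now let \<open>f q\<close> be the
  time needed, in some enumeration of a maximal clique, to find a string heavier than \<open>q\<close> that has already
  been joined to all nodes enumerated by time \<open>q\<close>, and suppose that \<open>f\<close> is dominated by the program \<open>e\<close>. The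
  program is total, so all edges of its witness nodes on the path come up eventually, and the clique
  contains such a node. Its edge to the string found by \<open>f q\<close> cannot come from the exception, for a step
  that heavy would make \<open>f\<close> exceed the program; but without the exception, the edge comes only after the
  program has converged at \<open>q\<close>, that is later than \<open>f q\<close> (\<open>maximal_clique_not_dominated\<close>).\<close>

section \<open>Soundness for omega-models\<close>

primrec val :: "(string \<Rightarrow> nat) \<Rightarrow> trm \<Rightarrow> nat" where
  "val s (Var x) = s x"
| "val s \<^bold>0 = 0"
| "val s \<^bold>1 = 1"
| "val s (t \<^bold>+ u) = val s t + val s u"
| "val s (t \<^bold>* u) = val s t * val s u"

primrec sat :: "nat set set \<Rightarrow> (string \<Rightarrow> nat) \<Rightarrow> (string \<Rightarrow> nat set) \<Rightarrow> fm \<Rightarrow> bool" where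
  "sat M s S (t \<^bold>= u) \<longleftrightarrow> val s t = val s u"
| "sat M s S (t \<^bold>< u) \<longleftrightarrow> val s t < val s u"
| "sat M s S (t \<^bold>\<in> X) \<longleftrightarrow> val s t \<in> S X"
| "sat M s S (\<^bold>\<not> \<phi>) \<longleftrightarrow> \<not> sat M s S \<phi>"
| "sat M s S (\<phi> \<^bold>\<longrightarrow> \<psi>) \<longleftrightarrow> (sat M s S \<phi> \<longrightarrow> sat M s S \<psi>)"
| "sat M s S (\<^bold>\<forall>x. \<phi>) \<longleftrightarrow> (\<forall>a. sat M (s(x := a)) S \<phi>)"
| "sat M s S (\<^bold>\<forall>\<^bold>S X. \<phi>) \<longleftrightarrow> (\<forall>A\<in>M. sat M s (S(X := A)) \<phi>)"

text \<open>Restricting the set variables to range over \<open>M\<close>, rather than quantifying over all assignments, is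
  what makes \<open>InstS\<close> sound.\<close>

definition valid :: "nat set set \<Rightarrow> fm \<Rightarrow> bool" where
  "valid M \<phi> \<longleftrightarrow> (\<forall>s S. range S \<subseteq> M \<longrightarrow> sat M s S \<phi>)"

lemma val_cong: "(\<And>x. x \<in> vars t \<Longrightarrow> s x = s' x) \<Longrightarrow> val s t = val s' t"
  by (induction t) auto

lemma sat_cong:
  "(\<And>x. x \<in> fvN \<phi> \<Longrightarrow> s x = s' x) \<Longrightarrow> (\<And>X. X \<in> fvS \<phi> \<Longrightarrow> S X = S' X) \<Longrightarrow>
    sat M s S \<phi> \<longleftrightarrow> sat M s' S' \<phi>"
proof (induction \<phi> arbitrary: s s' S S')
  case (Eq t u)
  then show ?case using val_cong[of t s s'] val_cong[of u s s'] by auto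
next
  case (Less t u)
  then show ?case using val_cong[of t s s'] val_cong[of u s s'] by auto
next
  case (Mem t X)
  then show ?case using val_cong[of t s s'] by auto
next
  case (Neg \<phi>)
  have "sat M s S \<phi> = sat M s' S' \<phi>" by (rule Neg.IH) (simp_all add: Neg.prems)
  then show ?case by simp
next
  case (Imp \<phi> \<psi>)
  have "sat M s S \<phi> = sat M s' S' \<phi>" by (rule Imp.IH) (simp_all add: Imp.prems)
  moreover have "sat M s S \<psi> = sat M s' S' \<psi>" by (rule Imp.IH) (simp_all add: Imp.prems)
  ultimately show ?case by simp
next
  case (AllN x \<phi>)
  then have "sat M (s(x := a)) S \<phi> = sat M (s'(x := a)) S' \<phi>" for a
    by (intro AllN.IH) auto
  then show ?case by simp
next
  case (AllS X \<phi>)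
  then have "sat M s (S(X := A)) \<phi> = sat M s' (S'(X := A)) \<phi>" for A
    by (intro AllS.IH) auto
  then show ?case by simp
qed

lemma val_subst_trm: "val s (subst_trm x t r) = val (s(x := val s t)) r"
  by (induction r) auto

lemma sat_substN:
  "free_forN t x \<phi> \<Longrightarrow> sat M s S (substN x t \<phi>) \<longleftrightarrow> sat M (s(x := val s t)) S \<phi>"
proof (induction \<phi> arbitrary: s S)
  case (AllN y \<phi>)
  show ?case
  proof (cases "y = x")
    case False
    have "sat M (s(y := a)) S (substN x t \<phi>) = sat M (s(x := val s t, y := a)) S \<phi>" for a
    proof (cases "x \<in> fvN \<phi>")
      case True
      with AllN.prems False have *: "y \<notin> vars t" "free_forN t x \<phi>" by auto
      have "val (s(y := a)) t = val s t" using *(1) by (intro val_cong) auto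
      then show ?thesis
        by (simp only: AllN.IH[OF *(2)] fun_upd_twist[OF False, of s a "val s t"])
    next
      case x: False
      have *: "subst_trm x t r = r" if "x \<notin> vars r" for r using that by (induction r) auto
      have "substN x t \<chi> = \<chi>" if "x \<notin> fvN \<chi>" for \<chi>
        using that by (induction \<chi>) (auto simp: *)
      then have "substN x t \<phi> = \<phi>" using x by blast
      moreover have "sat M (s(y := a)) S \<phi> = sat M (s(x := val s t, y := a)) S \<phi>"
        using x by (intro sat_cong) auto
      ultimately show ?thesis by simp
    qed
    then show ?thesis using False by (simp del: fun_upd_apply)
  qed (simp del: fun_upd_apply)
qed (auto simp: val_subst_trm)

lemma sat_substS:
  "free_forS Y X \<phi> \<Longrightarrow> sat M s S (substS X Y \<phi>) \<longleftrightarrow> sat M s (S(X := S Y)) \<phi>"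
proof (induction \<phi> arbitrary: s S)
  case (AllS Z \<phi>)
  show ?case
  proof (cases "Z = X")
    case False
    have "sat M s (S(Z := A)) (substS X Y \<phi>) = sat M s (S(X := S Y, Z := A)) \<phi>" for A
    proof (cases "X \<in> fvS \<phi>")
      case True
      with AllS.prems False have "Z \<noteq> Y" "free_forS Y X \<phi>" by auto
      then show ?thesis
        using AllS.IH[OF \<open>free_forS Y X \<phi>\<close>, of s "S(Z := A)"] fun_upd_twist[OF False, of S A "S Y"]
        by (simp only: fun_upd_other[OF \<open>Z \<noteq> Y\<close>[symmetric]])
    next
      case x: False
      have "substS X Y \<chi> = \<chi>" if "X \<notin> fvS \<chi>" for \<chi>
        using that by (induction \<chi>) auto
      then have "substS X Y \<phi> = \<phi>" using x by blast
      moreover have "sat M s (S(Z := A)) \<phi> = sat M s (S(X := S Y, Z := A)) \<phi>"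
        using x by (intro sat_cong) auto
      ultimately show ?thesis by simp
    qed
    then show ?thesis using False by (simp del: fun_upd_apply)
  qed (simp del: fun_upd_apply)
qed auto

theorem soundness:
  assumes "T \<turnstile> \<phi>" and ax: "\<And>\<psi>. \<psi> \<in> T \<Longrightarrow> valid M \<psi>"
  shows "valid M \<phi>"
  using assms(1)
proof induction
  case (GenN \<phi> x)
  then show ?case by (simp add: valid_def)
next
  case (GenS \<phi> X)
  then show ?case by (auto simp: valid_def image_subset_iff)
next
  case (InstN t x \<phi>)
  then show ?case by (simp add: valid_def sat_substN)
next
  case (InstS Y X \<phi>)
  then show ?case by (auto simp: valid_def sat_substS)
next
  case (DistN x \<phi> \<psi>)
  have "sat M (s(x := a)) S \<phi> = sat M s S \<phi>" for s S a
    using DistN by (intro sat_cong) auto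
  then show ?case by (simp add: valid_def)
next
  case (DistS X \<phi> \<psi>)
  have "sat M s (S(X := A)) \<phi> = sat M s S \<phi>" for s S A
    using DistS by (intro sat_cong) auto
  then show ?case by (simp add: valid_def)
next
  case (Leibniz s x \<phi> t)
  then show ?case by (auto simp: valid_def sat_substN)
next
  case (Axiom \<phi>)
  then show ?case by (rule ax)
next
  case (Contrapos \<phi> \<psi>)
  then show ?case by (auto simp: valid_def)
qed (simp_all add: valid_def)

lemma valid_semiring: "\<phi> \<in> semiring_axioms \<Longrightarrow> valid M \<phi>"
  unfolding semiring_axioms_def Let_def
  by (elim insertE emptyE; simp add: valid_def algebra_simps)
    (metis add.commute le_add_diff_inverse less_imp_le)

text \<open>The numbers of the model are the standard ones, so induction holds for every formula.\<close>

lemma valid_induction: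
  assumes "\<phi> \<in> Sigma01_induction"
  shows "valid M \<phi>"
proof -
  obtain n \<psi> where \<phi>: "\<phi> = (substN n \<^bold>0 \<psi> \<^bold>\<and>
      (\<^bold>\<forall>n. \<psi> \<^bold>\<longrightarrow> substN n (Var n \<^bold>+ \<^bold>1) \<psi>) \<^bold>\<longrightarrow> (\<^bold>\<forall>n. \<psi>))"
    using assms unfolding Sigma01_induction_def by blast
  have 0: "free_forN \<^bold>0 n \<chi>" and Suc: "free_forN (Var n \<^bold>+ \<^bold>1) n \<chi>" for \<chi>
    by (induction \<chi>) auto
  show ?thesis
    unfolding valid_def
  proof (intro allI impI)
    fix s S
    have *: "sat M (s(n := a)) S \<psi>"
      if "sat M (s(n := 0)) S \<psi>" "\<forall>a. sat M (s(n := a)) S \<psi> \<longrightarrow> sat M (s(n := Suc a)) S \<psi>" for a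
      by (induction a) (use that in blast)+
    show "sat M s S \<phi>"
      by (simp only: \<phi> sat.simps sat_substN[OF 0] sat_substN[OF Suc] val.simps
          fun_upd_upd fun_upd_same Suc_eq_plus1[symmetric]) (use * in blast)
  qed
qed

section \<open>Codes of finite sets and of binary strings\<close>

definition cpair :: "nat \<Rightarrow> nat \<Rightarrow> nat" where
  "cpair i j = (i + j) * (i + j) + i"

lemma cpair_inject [simp]: "cpair i j = cpair i' j' \<longleftrightarrow> i = i' \<and> j = j'"
proof
  have less: "(a + b) * (a + b) + a < (c + d) * (c + d) + c" if "a + b < c + d" for a b c d :: nat
  proof -
    have "(a + b) * (a + b) + a < Suc (a + b) * Suc (a + b)" by simp
    also have "\<dots> \<le> (c + d) * (c + d)" using that by (intro mult_le_mono) auto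
    finally show ?thesis by simp
  qed
  assume "cpair i j = cpair i' j'"
  then have eq: "(i + j) * (i + j) + i = (i' + j') * (i' + j') + i'"
    by (simp only: cpair_def)
  then have "i + j = i' + j'"
    using less[of i j i' j'] less[of i' j' i j] by (metis nat_neq_iff)
  with eq show "i = i' \<and> j = j'" by simp
qed simp

definition triple :: "nat \<Rightarrow> nat \<Rightarrow> nat \<Rightarrow> nat" where
  "triple k m n = cpair k (cpair m n)"

definition represents :: "nat \<Rightarrow> nat set \<Rightarrow> bool" where
  "represents c F \<longleftrightarrow> (\<exists>k m n. c = triple k m n \<and> F = {i. i < k \<and> (m * (i + 1) + 1) dvd n})"

definition members :: "nat \<Rightarrow> nat set" where
  "members c = {i. \<exists>k m n. c = triple k m n \<and> i < k \<and> (m * (i + 1) + 1) dvd n}"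

text \<open>The parameters \<open>k, m, n\<close> are determined by \<open>c\<close>, so a number represents at most one set, its set of
  members. Numbers that are not triples have no members either, but represent nothing.\<close>

lemma represents_members: "represents c F \<longleftrightarrow> (\<exists>k m n. c = triple k m n) \<and> members c = F"
  unfolding represents_def members_def by (auto simp: triple_def)

text \<open>Goedel's beta function: with \<open>m = k!\<close>, the moduli \<open>m (i + 1) + 1\<close> for \<open>i < k\<close> are pairwise coprime, since a
  common divisor of two of them divides the difference of the indices, which divides \<open>k!\<close>.\<close>

lemma coprime_moduli:
  assumes "i < k" "j < k" "i < j"
  shows "coprime (fact k * (i + 1) + 1) (fact k * (j + 1) + 1 :: nat)"
proof (rule coprimeI)
  fix d :: nat
  assume d: "d dvd fact k * (i + 1) + 1" "d dvd fact k * (j + 1) + 1"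
  then have "d dvd (i + 1) * (fact k * (j + 1) + 1)" "d dvd (j + 1) * (fact k * (i + 1) + 1)"
    using dvd_mult by blast+
  then have "d dvd (j + 1) * (fact k * (i + 1) + 1) - (i + 1) * (fact k * (j + 1) + 1)"
    by (rule dvd_diff_nat[rotated])
  also have "\<dots> = j - i" by (simp add: algebra_simps)
  also have "\<dots> dvd fact k" using assms by (intro dvd_fact) auto
  finally have "d dvd fact k * (i + 1)" by simp
  with d(1) show "is_unit d" by (metis dvd_add_right_iff)
qed

text \<open>The product of the moduli belonging to \<open>F\<close> is divisible by no other modulus.\<close>

lemma finite_set_represented:
  assumes "finite F"
  shows "\<exists>c. represents c F"
proof -
  obtain k where k: "F \<subseteq> {..<k}" using assms finite_nat_set_iff_bounded by auto
  let ?q = "\<lambda>i. fact k * (i + 1) + 1 :: nat"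
  let ?n = "\<Prod>i\<in>F. ?q i"
  have cop: "coprime (?q i) (?q j)" if "i < k" "j < k" "i \<noteq> j" for i j
    using coprime_moduli[of i k j] coprime_moduli[of j k i] that
    by (metis coprime_commute nat_neq_iff)
  have "?q i dvd ?n \<longleftrightarrow> i \<in> F" if "i < k" for i
  proof
    assume dvd: "?q i dvd ?n"
    show "i \<in> F"
    proof (rule ccontr)
      assume "i \<notin> F"
      then have "coprime (?q i) ?n" using k that by (intro prod_coprime_right cop) auto
      with dvd have "is_unit (?q i)" by (metis coprime_absorb_left)
      then show False by simp
    qed
  next
    assume "i \<in> F"
    then show "?q i dvd ?n" using assms by (rule dvd_prodI[rotated])
  qed
  then have "F = {i. i < k \<and> (fact k * (i + 1) + 1) dvd ?n}" using k by blast
  then show ?thesis unfolding represents_def by blast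
qed

definition canonical :: "nat \<Rightarrow> bool" where
  "canonical c \<longleftrightarrow> represents c (members c) \<and> 
    (\<forall>c'<c. represents c' (members c') \<longrightarrow> members c' \<noteq> members c)"

definition set_code :: "nat set \<Rightarrow> nat" where
  "set_code F = (LEAST c. represents c F)"

lemma set_code:
  assumes "finite F"
  shows "members (set_code F) = F" "canonical (set_code F)"
proof -
  have "represents (set_code F) F"
    using finite_set_represented[OF assms] unfolding set_code_def by (metis LeastI)
  moreover have "\<not> represents c F" if "c < set_code F" for c
    using that not_less_Least unfolding set_code_def by blast
  ultimately show "members (set_code F) = F" "canonical (set_code F)"
    unfolding canonical_def by (auto simp: represents_members)
qed

lemma canonical_eq_set_code: "canonical c \<Longrightarrow> c = set_code (members c)"
  unfolding canonical_def set_code_def 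
  by (rule Least_equality[symmetric]) (auto simp: represents_members not_less[symmetric])

definition graph :: "bool list \<Rightarrow> nat set" where
  "graph \<sigma> = {cpair j (of_bool (\<sigma> ! j)) | j. j < length \<sigma>}"

definition str_code :: "bool list \<Rightarrow> nat" where
  "str_code \<sigma> = set_code (graph \<sigma>)"

lemma finite_graph: "finite (graph \<sigma>)"
  unfolding graph_def by simp

lemma cpair_in_graph: "cpair j v \<in> graph \<sigma> \<longleftrightarrow> j < length \<sigma> \<and> v = of_bool (\<sigma> ! j)"
  unfolding graph_def by auto

lemma members_str_code [simp]: "members (str_code \<sigma>) = graph \<sigma>"
  by (simp add: str_code_def set_code finite_graph)

definition is_seq :: "nat \<Rightarrow> nat \<Rightarrow> bool" where
  "is_seq c l \<longleftrightarrow> canonical c \<and> (\<forall>i\<in>members c. \<exists>j v. j < l \<and> i = cpair j v) \<and>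
    (\<forall>j<l. \<exists>v. cpair j v \<in> members c \<and> (\<forall>u. cpair j u \<in> members c \<longrightarrow> u = v))"

lemma is_seq_str_code: "is_seq (str_code \<sigma>) (length \<sigma>)"
  unfolding is_seq_def members_str_code cpair_in_graph
  by (auto simp: str_code_def set_code finite_graph graph_def)

definition binary_code :: "nat \<Rightarrow> bool" where
  "binary_code c \<longleftrightarrow> (\<exists>l. is_seq c l) \<and> (\<forall>j v. cpair j v \<in> members c \<longrightarrow> v = 0 \<or> v = 1)"

lemma binary_code_iff: "binary_code c \<longleftrightarrow> c \<in> range str_code"
proof
  assume "binary_code c"
  then obtain l where seq: "is_seq c l" and bin: "\<And>j v. cpair j v \<in> members c \<Longrightarrow> v = 0 \<or> v = 1"
    unfolding binary_code_def by blast
  have graph: "i \<in> members c \<Longrightarrow> \<exists>j v. j < l \<and> i = cpair j v" for i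
    using seq by (simp add: is_seq_def)
  have fn: "j < l \<Longrightarrow> \<exists>v. cpair j v \<in> members c \<and> (\<forall>u. cpair j u \<in> members c \<longrightarrow> u = v)" for j
    using seq by (simp add: is_seq_def)
  define \<sigma> where "\<sigma> = map (\<lambda>j. cpair j 1 \<in> members c) [0..<l]"
  have iff: "cpair j v \<in> members c \<longleftrightarrow> j < l \<and> v = of_bool (cpair j 1 \<in> members c)" for j v
  proof
    assume v: "cpair j v \<in> members c"
    have "j < l" using graph[OF v] by auto
    then obtain w where "\<And>u. cpair j u \<in> members c \<Longrightarrow> u = w"
      using fn by blast
    then have "cpair j 1 \<in> members c \<Longrightarrow> 1 = v"
      using v by blast
    then show "j < l \<and> v = of_bool (cpair j 1 \<in> members c)"
      using bin[OF v] v \<open>j < l\<close> by auto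
  next
    assume *: "j < l \<and> v = of_bool (cpair j 1 \<in> members c)"
    then obtain u where u: "cpair j u \<in> members c" using fn by blast
    then have "u = 0 \<or> u = 1" by (rule bin)
    moreover have "cpair j 1 \<in> members c \<Longrightarrow> 1 = u"
      using fn[of j] * u by blast
    ultimately have "u = v" using * u by auto
    with u show "cpair j v \<in> members c" by simp
  qed
  have "cpair j v \<in> members c \<longleftrightarrow> cpair j v \<in> graph \<sigma>" for j v
    by (subst iff) (auto simp: cpair_in_graph \<sigma>_def)
  moreover have "\<exists>j v. i = cpair j v" if "i \<in> members c \<or> i \<in> graph \<sigma>" for i
    using that graph unfolding graph_def by blast
  ultimately have "members c = graph \<sigma>" by blast
  then have "c = str_code \<sigma>"
    using seq canonical_eq_set_code unfolding is_seq_def str_code_def by metis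
  then show "c \<in> range str_code" by simp
next
  assume "c \<in> range str_code"
  then obtain \<sigma> where "c = str_code \<sigma>" by blast
  then show "binary_code c"
    unfolding binary_code_def using is_seq_str_code by (auto simp: cpair_in_graph)
qed

text \<open>Only finitely many codes belong to strings of length at most \<open>l\<close>, so an unbounded tree contains longer
  strings, and hence their restrictions to length \<open>l\<close>.\<close>

lemma infinite_tree_levels:
  assumes T: "T \<subseteq> range str_code"
    and closed: "\<And>\<sigma> i. str_code \<sigma> \<in> T \<Longrightarrow> str_code (take i \<sigma>) \<in> T"
    and inf: "\<forall>x. \<exists>y>x. y \<in> T"
  shows "\<exists>\<sigma>. length \<sigma> = l \<and> str_code \<sigma> \<in> T"
proof -
  have "finite {\<sigma>::bool list. length \<sigma> \<le> l}"
    using finite_lists_length_le[of "UNIV :: bool set" l] by simp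
  then have "finite (str_code ` {\<sigma>. length \<sigma> \<le> l})" by simp
  then obtain x where x: "\<forall>y\<in>str_code ` {\<sigma>. length \<sigma> \<le> l}. y \<le> x"
    using finite_nat_set_iff_bounded_le by auto
  obtain y where "y > x" "y \<in> T" using inf by blast
  moreover then obtain \<tau> where \<tau>: "y = str_code \<tau>" using T by blast
  ultimately have "\<not> length \<tau> \<le> l" using x by force
  then have "length (take l \<tau>) = l" by simp
  then show ?thesis using closed[of \<tau> l] \<open>y \<in> T\<close> \<tau> by blast
qed

subsection \<open>The formulas of the coding\<close>

text \<open>The formulas of the coding bind fixed variable names; each of the following lemmas assumes that the
  terms avoid the names that would be captured.\<close>

lemma val_pair [simp]: "val s (pair t u) = cpair (val s t) (val s u)"
  by (simp add: pair_def cpair_def)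

lemma vars_pair [simp]: "vars (pair t u) = vars t \<union> vars u"
  by (auto simp: pair_def)

lemma val_upd [simp]: "x \<notin> vars t \<Longrightarrow> val (s(x := a)) t = val s t"
  by (rule val_cong) auto

lemma sat_is_triple:
  assumes "vars c \<inter> {''k'', ''m'', ''n''} = {}"
  shows "sat M s S (is_triple c) \<longleftrightarrow> represents (val s c) (members (val s c))"
  using assms by (simp add: is_triple_def represents_members triple_def)

lemma sat_fin_mem:
  assumes "vars i \<inter> {''d'', ''k'', ''m'', ''n''} = {}" "vars c \<inter> {''d'', ''k'', ''m'', ''n''} = {}"
  shows "sat M s S (fin_mem i c) \<longleftrightarrow> val s i \<in> members (val s c)"
  using assms
  by (simp add: fin_mem_def Let_def members_def triple_def dvd_def)
    (metis (no_types, opaque_lifting))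

lemma sat_fin_code:
  assumes "vars t \<inter> {''c'', ''i'', ''d'', ''k'', ''m'', ''n''} = {}"
  shows "sat M s S (fin_code t) \<longleftrightarrow> canonical (val s t)"
  using assms by (simp add: fin_code_def Let_def sat_is_triple sat_fin_mem canonical_def)
    (simp add: set_eq_iff, blast)

lemma sat_seq_of_length:
  assumes "vars t \<inter> {''c'', ''d'', ''i'', ''j'', ''k'', ''m'', ''n'', ''u'', ''v''} = {}"
    "vars l \<inter> {''c'', ''d'', ''i'', ''j'', ''k'', ''m'', ''n'', ''u'', ''v''} = {}"
  shows "sat M s S (seq_of_length t l) \<longleftrightarrow> is_seq (val s t) (val s l)"
  using assms by (simp add: seq_of_length_def Let_def sat_fin_code sat_fin_mem is_seq_def Ball_def)

lemma sat_binary_string: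
  assumes "vars t \<inter> {''c'', ''d'', ''i'', ''j'', ''k'', ''m'', ''n'', ''u'', ''v'', ''w''} = {}"
  shows "sat M s S (binary_string t) \<longleftrightarrow> val s t \<in> range str_code"
  unfolding binary_code_iff[symmetric]
  using assms by (simp add: binary_string_def Let_def sat_seq_of_length sat_fin_mem binary_code_def)

lemma sat_binary_tree:
  assumes "sat M s S (binary_tree T)"
  shows "S T \<subseteq> range str_code \<and>
    (\<forall>\<sigma> \<tau>. str_code \<tau> \<in> S T \<longrightarrow> graph \<sigma> \<subseteq> graph \<tau> \<longrightarrow> str_code \<sigma> \<in> S T)"
proof -
  have *: "\<forall>c. c \<in> S T \<longrightarrow> c \<in> range str_code"
    "\<forall>\<sigma>. (\<forall>d. d \<in> S T \<longrightarrow> (\<exists>i. i \<in> graph \<sigma> \<and> i \<notin> members d)) \<or> str_code \<sigma> \<in> S T"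
    using assms by (simp_all add: binary_tree_def Let_def sat_binary_string initial_segment_def sat_fin_mem)
  have "str_code \<sigma> \<in> S T" if "str_code \<tau> \<in> S T" "graph \<sigma> \<subseteq> graph \<tau>" for \<sigma> \<tau>
    using *(2)[rule_format, of \<sigma>] that members_str_code[of \<tau>] by blast
  with *(1) show ?thesis by blast
qed

lemma sat_infinite_set: "sat M s S (infinite_set X) \<longleftrightarrow> (\<forall>x. \<exists>y>x. y \<in> S X)"
  by (simp add: infinite_set_def)

lemma sat_path_of:
  assumes F: "S F = {cpair j (of_bool (b j)) | j. True}"
    and T: "\<And>l. str_code (map b [0..<l]) \<in> S T"
  shows "sat M s S (path_of F T)"
proof -
  have "sat M s S (binary_function F)"
    by (auto simp add: binary_function_def Let_def F)
  moreover have "\<exists>c. c \<in> S T \<and> is_seq c l \<and> (\<forall>j v. cpair j v \<in> members c \<longrightarrow> cpair j v \<in> S F)" for l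
    using T[of l] is_seq_str_code[of "map b [0..<l]"]
    by (intro exI[of _ "str_code (map b [0..<l])"]) (auto simp: cpair_in_graph F)
  ultimately show ?thesis
    by (simp add: path_of_def Let_def sat_seq_of_length sat_fin_mem)
qed

lemma valid_WKL_if_paths:
  assumes "\<And>T. T \<in> M \<Longrightarrow> (\<And>\<sigma> i. str_code \<sigma> \<in> T \<Longrightarrow> str_code (take i \<sigma>) \<in> T) \<Longrightarrow>
      (\<And>l. \<exists>\<sigma>. length \<sigma> = l \<and> str_code \<sigma> \<in> T) \<Longrightarrow>
      \<exists>b. (\<forall>l. str_code (map b [0..<l]) \<in> T) \<and> {cpair j (of_bool (b j)) | j. True} \<in> M"
  shows "valid M WKL"
  unfolding valid_def
proof (intro allI impI)
  fix s S
  have "\<exists>F\<in>M. sat M s (S(''T'' := T, ''F'' := F)) (path_of ''F'' ''T'')"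
    if T: "T \<in> M" and tree: "sat M s (S(''T'' := T)) (binary_tree ''T'')"
      and infinite: "sat M s (S(''T'' := T)) (infinite_set ''T'')" for T
  proof -
    have sub: "T \<subseteq> range str_code" and inf: "\<forall>x. \<exists>y>x. y \<in> T"
      and closed: "\<And>\<sigma> \<tau>. str_code \<tau> \<in> T \<Longrightarrow> graph \<sigma> \<subseteq> graph \<tau> \<Longrightarrow> str_code \<sigma> \<in> T"
      using sat_binary_tree[OF tree] infinite by (simp_all add: sat_infinite_set)
    have cl: "str_code (take i \<sigma>) \<in> T" if "str_code \<sigma> \<in> T" for \<sigma> i
      by (rule closed[OF that]) (auto simp: graph_def)
    obtain b where b: "\<forall>l. str_code (map b [0..<l]) \<in> T" "{cpair j (of_bool (b j)) | j. True} \<in> M"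
      using assms[OF T cl infinite_tree_levels[OF sub cl inf]] by blast
    then show ?thesis
      by (intro bexI[of _ "{cpair j (of_bool (b j)) | j. True}"] sat_path_of[where b = b]) auto
  qed
  then show "sat M s S WKL"
    unfolding WKL_def sat.simps by blast
qed

section \<open>Computations by stages\<close>

text \<open>A table gives the results, known at some stage, of a computation with a given oracle, program and
  input.\<close>

type_synonym table = "nat set \<Rightarrow> nat \<Rightarrow> nat \<Rightarrow> nat option"

text \<open>An operation is what a program does at a single stage: from the stage, the tables of the stages so far,
  the finite part of the oracle, and the input, it produces an answer or decides to wait.\<close>

type_synonym oper = "nat \<Rightarrow> (nat \<Rightarrow> table) \<Rightarrow> nat set \<Rightarrow> nat \<Rightarrow> nat option"

definition history :: "nat \<Rightarrow> (nat \<Rightarrow> table) \<Rightarrow> nat \<Rightarrow> table" where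
  "history n H k = (if k \<le> n then H k else (\<lambda>_ _ _. None))"

lemma history_le [simp]: "k \<le> n \<Longrightarrow> history n H k = H k"
  by (simp add: history_def)

definition columns :: "nat \<Rightarrow> nat set \<Rightarrow> nat set" where
  "columns m X = {c \<in> X. fst (prod_decode c) < m}"

lemma columns_columns: "m \<le> m' \<Longrightarrow> columns m (columns m' X) = columns m X"
  by (auto simp: columns_def)

lemma columns_Int: "columns m (X \<inter> A) = columns m X \<inter> A"
  by (auto simp: columns_def)

locale machine =
  fixes ops :: "nat \<Rightarrow> oper"
begin

text \<open>The first answer is final. The operation receives all earlier tables, for all oracles and
  programs: this makes evaluation universal by definition. The guard \<open>k \<le> n\<close> is needed for termination.\<close>

fun ev :: "nat \<Rightarrow> nat set \<Rightarrow> nat \<Rightarrow> nat \<Rightarrow> nat option" where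
  "ev 0 X e x = None"
| "ev (Suc n) X e x =
    (case ev n X e x of
      Some y \<Rightarrow> Some y
    | None \<Rightarrow> ops e n (\<lambda>k Y i z. if k \<le> n then ev k Y i z else None) (X \<inter> {..<n}) x)"

definition step :: "nat \<Rightarrow> nat set \<Rightarrow> nat \<Rightarrow> nat \<Rightarrow> nat option" where
  "step n X e x = ops e n (history n ev) (X \<inter> {..<n}) x"

lemma ev_Suc: "ev (Suc n) X e x = (case ev n X e x of Some y \<Rightarrow> Some y | None \<Rightarrow> step n X e x)"
proof -
  have "(\<lambda>k Y i z. if k \<le> n then ev k Y i z else None) = history n ev"
    by (intro ext) (simp add: history_def)
  then show ?thesis by (simp only: ev.simps step_def)
qed

declare ev.simps(2) [simp del]

lemma ev_mono: "ev n X e x = Some y \<Longrightarrow> n \<le> k \<Longrightarrow> ev k X e x = Some y"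
proof (induction k)
  case (Suc k)
  then show ?case by (cases "n = Suc k") (auto simp: ev_Suc)
qed simp

lemma ev_unique: "ev n X e x = Some y \<Longrightarrow> ev k X e x = Some z \<Longrightarrow> y = z"
  by (metis ev_mono linear option.inject)

text \<open>The use principle: a computation of \<open>n\<close> stages reads its oracle only below \<open>n\<close>.\<close>

lemma ev_use: "X \<inter> {..<n} = Y \<inter> {..<n} \<Longrightarrow> ev n X = ev n Y"
proof (induction n)
  case (Suc n)
  then have "X \<inter> {..<n} = Y \<inter> {..<n}"
    by (metis Int_assoc inf.absorb_iff2 lessThan_subset_iff le_Suc_eq order_refl)
  then have "ev n X = ev n Y" "step n X = step n Y"
    using Suc.IH by (simp_all add: step_def fun_eq_iff)
  then show ?case by (intro ext) (simp add: ev_Suc split: option.split)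
qed (intro ext, simp)

lemma ev_Int: "n \<le> k \<Longrightarrow> ev n (X \<inter> {..<k}) = ev n X"
  by (rule ev_use) auto

lemma ev_from_step: "ev n X e x = Some y \<Longrightarrow> \<exists>k<n. step k X e x = Some y"
proof (induction n)
  case (Suc n)
  then show ?case by (cases "ev n X e x") (auto simp: ev_Suc intro: less_SucI)
qed simp

lemma step_converges: "step n X e x \<noteq> None \<Longrightarrow> ev (Suc n) X e x \<noteq> None"
  by (auto simp: ev_Suc split: option.split)

definition computes :: "nat set \<Rightarrow> nat \<Rightarrow> (nat \<Rightarrow> nat) \<Rightarrow> bool" where
  "computes X e f \<longleftrightarrow> (\<forall>x. \<exists>n. ev n X e x = Some (f x))"

abbreviation decides :: "nat set \<Rightarrow> nat \<Rightarrow> nat set \<Rightarrow> bool" where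
  "decides X e Z \<equiv> computes X e (\<lambda>x. of_bool (x \<in> Z))"

lemma computesI:
  assumes "\<And>x n y. step n X e x = Some y \<Longrightarrow> y = f x" and "\<And>x. \<exists>n. step n X e x \<noteq> None"
  shows "computes X e f"
  unfolding computes_def
proof
  fix x
  obtain n where "step n X e x \<noteq> None" using assms(2) by blast
  then obtain y where y: "ev (Suc n) X e x = Some y" using step_converges by blast
  then have "y = f x" using ev_from_step assms(1) by blast
  with y show "\<exists>n. ev n X e x = Some (f x)" by blast
qed

lemma computes_ev: "computes X e f \<Longrightarrow> ev n X e x = Some y \<Longrightarrow> y = f x"
  unfolding computes_def using ev_unique by blast

lemma computes_below:
  assumes "computes X e f"
  shows "\<exists>n. \<forall>k\<ge>n. \<forall>x<b. ev k X e x = Some (f x)"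
proof (induction b)
  case (Suc b)
  then obtain n where n: "\<forall>k\<ge>n. \<forall>x<b. ev k X e x = Some (f x)" by blast
  obtain n' where "ev n' X e b = Some (f b)" using assms unfolding computes_def by blast
  then have "\<forall>k\<ge>n'. ev k X e b = Some (f b)" using ev_mono by blast
  with n have "\<forall>k\<ge>max n n'. \<forall>x<Suc b. ev k X e x = Some (f x)"
    by (auto simp: less_Suc_eq)
  then show ?case by blast
qed simp

lemma op_index: "range F \<subseteq> range ops \<Longrightarrow> \<exists>i. ops i = F p"
proof -
  assume "range F \<subseteq> range ops"
  then have "F p \<in> range ops" by blast
  then show "\<exists>i. ops i = F p" by (metis rangeE)
qed

text \<open>Computing from finitely many columns, rather than from all of \<open>X\<close>, leaves room for the later columns
  of \<open>X\<close> to solve problems posed by the earlier ones.\<close>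

definition sets_of :: "nat set \<Rightarrow> nat set set" where
  "sets_of X = {Z. \<exists>m e. decides (columns m X) e Z}"

end

section \<open>Comprehension\<close>

text \<open>Bounded formulas do not quantify over sets, so an operation may evaluate them without reference to
  the model.\<close>

lemma sat_Delta0_model: "\<phi> \<in> Delta0 \<Longrightarrow> sat M s S \<phi> \<longleftrightarrow> sat M' s S \<phi>"
  by (induction arbitrary: s rule: Delta0.induct) simp_all

lemma uniform_use:
  fixes b :: nat
  assumes "\<And>a. \<exists>N. \<forall>S'. (\<forall>Z\<in>V. \<forall>c<N. c \<in> S' Z \<longleftrightarrow> c \<in> S Z) \<longrightarrow> P a S'"
  shows "\<exists>N::nat. \<forall>a<b. \<forall>S'. (\<forall>Z\<in>V. \<forall>c<N. c \<in> S' Z \<longleftrightarrow> c \<in> S Z) \<longrightarrow> P a S'"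
proof (induction b)
  case (Suc b)
  then obtain N :: nat where N: "\<And>a S'. a < b \<Longrightarrow> \<forall>Z\<in>V. \<forall>c<N. c \<in> S' Z \<longleftrightarrow> c \<in> S Z \<Longrightarrow> P a S'"
    by blast
  obtain N' :: nat where N': "\<And>S'. \<forall>Z\<in>V. \<forall>c<N'. c \<in> S' Z \<longleftrightarrow> c \<in> S Z \<Longrightarrow> P b S'"
    using assms by blast
  have "P a S'" if "a < Suc b" "\<forall>Z\<in>V. \<forall>c<max N N'. c \<in> S' Z \<longleftrightarrow> c \<in> S Z" for a S'
    using that N[of a S'] N'[of S'] by (cases "a = b") auto
  then show ?case by blast
qed simp

text \<open>The truth value of a bounded formula depends on finitely many elements of its set parameters.\<close>

lemma sat_Delta0_use:
  "\<phi> \<in> Delta0 \<Longrightarrow>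
    \<exists>N. \<forall>S'. (\<forall>Z\<in>fvS \<phi>. \<forall>c<N. c \<in> S' Z \<longleftrightarrow> c \<in> S Z) \<longrightarrow> (sat M s S' \<phi> \<longleftrightarrow> sat M s S \<phi>)"
proof (induction arbitrary: s rule: Delta0.induct)
  case (3 t X)
  show ?case by (intro exI[of _ "Suc (val s t)"]) auto
next
  case (4 \<phi>)
  then show ?case by simp
next
  case (5 \<phi> \<psi>)
  obtain N N' where
    N: "\<And>S'. (\<forall>Z\<in>fvS \<phi>. \<forall>c<N. c \<in> S' Z \<longleftrightarrow> c \<in> S Z) \<Longrightarrow> (sat M s S' \<phi> \<longleftrightarrow> sat M s S \<phi>)"
    and N': "\<And>S'. (\<forall>Z\<in>fvS \<psi>. \<forall>c<N'. c \<in> S' Z \<longleftrightarrow> c \<in> S Z) \<Longrightarrow> (sat M s S' \<psi> \<longleftrightarrow> sat M s S \<psi>)"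
    using 5(3)[of s] 5(4)[of s] by blast
  have "sat M s S' (\<phi> \<^bold>\<longrightarrow> \<psi>) \<longleftrightarrow> sat M s S (\<phi> \<^bold>\<longrightarrow> \<psi>)"
    if "\<forall>Z\<in>fvS (\<phi> \<^bold>\<longrightarrow> \<psi>). \<forall>c<max N N'. c \<in> S' Z \<longleftrightarrow> c \<in> S Z" for S'
  proof -
    have "sat M s S' \<phi> \<longleftrightarrow> sat M s S \<phi>" using that by (intro N) auto
    moreover have "sat M s S' \<psi> \<longleftrightarrow> sat M s S \<psi>" using that by (intro N') auto
    ultimately show ?thesis by simp
  qed
  then show ?case by (intro exI[of _ "max N N'"] allI impI)
next
  case (6 \<phi> x t)
  have use: "\<exists>N. \<forall>S'. (\<forall>Z\<in>fvS \<phi>. \<forall>c<N. c \<in> S' Z \<longleftrightarrow> c \<in> S Z) \<longrightarrow>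
      (sat M (s(x := a)) S' \<phi> \<longleftrightarrow> sat M (s(x := a)) S \<phi>)" for a
    by (rule 6(3))
  obtain N where N: "\<forall>a<val s t. \<forall>S'. (\<forall>Z\<in>fvS \<phi>. \<forall>c<N. c \<in> S' Z \<longleftrightarrow> c \<in> S Z) \<longrightarrow>
      (sat M (s(x := a)) S' \<phi> \<longleftrightarrow> sat M (s(x := a)) S \<phi>)"
    by (rule exE[OF uniform_use[where P = "\<lambda>a S'. sat M (s(x := a)) S' \<phi> \<longleftrightarrow> sat M (s(x := a)) S \<phi>", OF use]])
  show ?case
  proof (intro exI[of _ N] allI impI)
    fix S'
    assume agree: "\<forall>Z\<in>fvS (\<^bold>\<forall>x. Var x \<^bold>< t \<^bold>\<longrightarrow> \<phi>). \<forall>c<N. c \<in> S' Z \<longleftrightarrow> c \<in> S Z"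
    have "\<forall>Z\<in>fvS \<phi>. \<forall>c<N. c \<in> S' Z \<longleftrightarrow> c \<in> S Z"
      using agree by simp
    with N have "\<forall>a<val s t. sat M (s(x := a)) S' \<phi> \<longleftrightarrow> sat M (s(x := a)) S \<phi>"
      by blast
    then show "sat M s S' (\<^bold>\<forall>x. Var x \<^bold>< t \<^bold>\<longrightarrow> \<phi>) \<longleftrightarrow> sat M s S (\<^bold>\<forall>x. Var x \<^bold>< t \<^bold>\<longrightarrow> \<phi>)"
      using 6(2) by simp
  qed
next
  case (7 \<phi> x t)
  have use: "\<exists>N. \<forall>S'. (\<forall>Z\<in>fvS \<phi>. \<forall>c<N. c \<in> S' Z \<longleftrightarrow> c \<in> S Z) \<longrightarrow>
      (sat M (s(x := a)) S' \<phi> \<longleftrightarrow> sat M (s(x := a)) S \<phi>)" for a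
    by (rule 7(3))
  obtain N where N: "\<forall>a<val s t. \<forall>S'. (\<forall>Z\<in>fvS \<phi>. \<forall>c<N. c \<in> S' Z \<longleftrightarrow> c \<in> S Z) \<longrightarrow>
      (sat M (s(x := a)) S' \<phi> \<longleftrightarrow> sat M (s(x := a)) S \<phi>)"
    by (rule exE[OF uniform_use[where P = "\<lambda>a S'. sat M (s(x := a)) S' \<phi> \<longleftrightarrow> sat M (s(x := a)) S \<phi>", OF use]])
  show ?case
  proof (intro exI[of _ N] allI impI)
    fix S'
    assume agree: "\<forall>Z\<in>fvS (\<^bold>\<exists>x. Var x \<^bold>< t \<^bold>\<and> \<phi>). \<forall>c<N. c \<in> S' Z \<longleftrightarrow> c \<in> S Z"
    have "\<forall>Z\<in>fvS \<phi>. \<forall>c<N. c \<in> S' Z \<longleftrightarrow> c \<in> S Z"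
      using agree by simp
    with N have "\<forall>a<val s t. sat M (s(x := a)) S' \<phi> \<longleftrightarrow> sat M (s(x := a)) S \<phi>"
      by blast
    then show "sat M s S' (\<^bold>\<exists>x. Var x \<^bold>< t \<^bold>\<and> \<phi>) \<longleftrightarrow> sat M s S (\<^bold>\<exists>x. Var x \<^bold>< t \<^bold>\<and> \<phi>)"
      using 7(2) by simp
  qed
qed auto

text \<open>The list \<open>ps\<close> describes set parameters by a number of columns and a program that decides the parameter
  from these columns; an interpretation of the set variables is consistent if it agrees with the values
  computed so far.\<close>

definition consistent :: "table \<Rightarrow> nat set \<Rightarrow> (string \<times> nat \<times> nat) list \<Rightarrow> (string \<Rightarrow> nat set) \<Rightarrow> bool" where
  "consistent E X ps S \<longleftrightarrow> (\<forall>(Z, m, e)\<in>set ps. \<forall>c v. E (columns m X) e c = Some v \<longrightarrow> (c \<in> S Z \<longleftrightarrow> v = 1))"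

definition assignment :: "(string \<times> nat) list \<Rightarrow> string \<Rightarrow> nat" where
  "assignment vs v = (case map_of vs v of Some u \<Rightarrow> u | None \<Rightarrow> 0)"

text \<open>Searches simultaneously for a witness to \<open>\<^bold>\<exists>x. \<phi>\<close> and for a counterexample to \<open>\<^bold>\<forall>y. \<psi>\<close>, accepting only
  those that are confirmed by the part of the set parameters computed so far.\<close>

fun compr_op :: "fm \<times> string \<times> fm \<times> string \<times> string \<times> (string \<times> nat) list \<times> (string \<times> nat \<times> nat) list \<Rightarrow> oper" where
  "compr_op (\<phi>, x, \<psi>, y, n, vs, ps) k H X a =
    (if \<exists>b. \<forall>S. consistent (H k) X ps S \<longrightarrow> sat {} ((assignment vs)(n := a, x := b)) S \<phi> then Some 1
     else if \<exists>b. \<forall>S. consistent (H k) X ps S \<longrightarrow> \<not> sat {} ((assignment vs)(n := a, y := b)) S \<psi> then Some 0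
     else None)"

instance trm :: countable by countable_datatype
instance fm :: countable by countable_datatype

lemma finite_fv: "finite (fvN \<phi>)" "finite (fvS \<phi>)"
proof -
  have "finite (vars t)" for t by (induction t) auto
  then show "finite (fvN \<phi>)" "finite (fvS \<phi>)" by (induction \<phi>) auto
qed

context machine
begin

text \<open>The search of \<open>compr_op\<close> is sound because the true set parameters are consistent with all computed values.
  It succeeds because, by \<open>sat_Delta0_use\<close>, a witness or counterexample is confirmed once enough
  values have been computed.\<close>

lemma valid_comprehension:
  assumes ops: "range compr_op \<subseteq> range ops" and ax: "\<chi> \<in> Delta01_comprehension"
  shows "valid (sets_of X) \<chi>"
proof -
  obtain n W x \<phi> y \<psi> where \<chi>: "\<chi> = ((\<^bold>\<forall>n. (\<^bold>\<exists>x. \<phi>) \<^bold>\<longleftrightarrow> (\<^bold>\<forall>y. \<psi>)) \<^bold>\<longrightarrow> (\<^bold>\<exists>\<^bold>S W. \<^bold>\<forall>n. Var n \<^bold>\<in> W \<^bold>\<longleftrightarrow> (\<^bold>\<exists>x. \<phi>)))"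
    and D: "\<phi> \<in> Delta0" "\<psi> \<in> Delta0" and W: "W \<notin> fvS \<phi>"
    using ax unfolding Delta01_comprehension_def Sigma01_def Pi01_def by auto
  let ?M = "sets_of X"
  have main: "\<exists>A\<in>?M. \<forall>a. a \<in> A \<longleftrightarrow> (\<exists>b. sat ?M (s(n := a, x := b)) S \<phi>)"
    if S: "range S \<subseteq> ?M"
      and eq: "\<And>a. (\<exists>b. sat ?M (s(n := a, x := b)) S \<phi>) \<longleftrightarrow> (\<forall>b. sat ?M (s(n := a, y := b)) S \<psi>)" for s S
  proof -
    define V where "V = fvS \<phi> \<union> fvS \<psi>"
    have "\<exists>m e. decides (columns m X) e (S Z)" for Z using S unfolding sets_of_def by blast
    then obtain mf ef where dec: "\<And>Z. decides (columns (mf Z) X) (ef Z) (S Z)" by metis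
    obtain zs where zs: "set zs = V" using finite_list[of V] finite_fv unfolding V_def by auto
    obtain us where us: "set us = fvN \<phi> \<union> fvN \<psi>" using finite_list finite_fv by (metis finite_UnI)
    define ps where "ps = map (\<lambda>Z. (Z, mf Z, ef Z)) zs"
    define vs where "vs = map (\<lambda>v. (v, s v)) us"
    define m where "m = Max (insert 0 (mf ` V))"
    have m: "mf Z \<le> m" if "Z \<in> V" for Z
      unfolding m_def using that finite_fv by (intro Max_ge) (auto simp: V_def)
    have asg: "assignment vs v = s v" if "v \<in> fvN \<phi> \<union> fvN \<psi>" for v
      using that unfolding us[symmetric] assignment_def vs_def
      by (simp add: map_of_map_restrict)
    obtain e where e: "ops e = compr_op (\<phi>, x, \<psi>, y, n, vs, ps)" using op_index[OF ops] by blast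
    have columns_m: "columns (mf Z) (columns m X \<inter> {..<k}) = columns (mf Z) X \<inter> {..<k}" if "Z \<in> V" for Z k
      using m[OF that] by (simp add: columns_Int columns_columns)
    let ?c = "\<lambda>k. consistent (ev k) (columns m X \<inter> {..<k}) ps"
    have c_iff: "?c k S' \<longleftrightarrow>
        (\<forall>Z\<in>V. \<forall>c v. ev k (columns (mf Z) X) (ef Z) c = Some v \<longrightarrow> (c \<in> S' Z \<longleftrightarrow> v = 1))" for k S'
      by (simp add: consistent_def ps_def zs columns_m ev_Int)
    have c_S: "?c k S" for k
      unfolding c_iff by (auto dest!: computes_ev[OF dec] simp: of_bool_def split: if_splits)
    \<comment> \<open>From some stage on, consistency determines the set parameters below \<open>N\<close>.\<close>
    have c_below: "\<exists>k. \<forall>S'. ?c k S' \<longrightarrow> (\<forall>Z\<in>V. \<forall>c<N. c \<in> S' Z \<longleftrightarrow> c \<in> S Z)" for N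
    proof -
      obtain kf where kf: "\<And>Z k c. k \<ge> kf Z \<Longrightarrow> c < N \<Longrightarrow> ev k (columns (mf Z) X) (ef Z) c = Some (of_bool (c \<in> S Z))"
        using computes_below[OF dec] by metis
      define k where "k = Max (insert 0 (kf ` V))"
      have "kf Z \<le> k" if "Z \<in> V" for Z
        unfolding k_def using that finite_fv by (intro Max_ge) (auto simp: V_def)
      then have "c \<in> S' Z \<longleftrightarrow> c \<in> S Z" if "?c k S'" "Z \<in> V" "c < N" for S' Z c
        using that kf[of Z k c] unfolding c_iff by (auto simp: of_bool_def split: if_splits)
      then show ?thesis by blast
    qed
    have \<phi>_eq: "sat {} ((assignment vs)(n := a, x := b)) S' \<phi> \<longleftrightarrow> sat ?M (s(n := a, x := b)) S' \<phi>" for a b S'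
      unfolding sat_Delta0_model[OF D(1), of "{}" _ _ ?M] by (intro sat_cong) (simp_all add: asg)
    have \<psi>_eq: "sat {} ((assignment vs)(n := a, y := b)) S' \<psi> \<longleftrightarrow> sat ?M (s(n := a, y := b)) S' \<psi>" for a b S'
      unfolding sat_Delta0_model[OF D(2), of "{}" _ _ ?M] by (intro sat_cong) (simp_all add: asg)
    define A where "A = {a. \<exists>b. sat ?M (s(n := a, x := b)) S \<phi>}"
    have step: "step k (columns m X) e a =
       (if \<exists>b. \<forall>S'. ?c k S' \<longrightarrow> sat ?M (s(n := a, x := b)) S' \<phi> then Some 1
        else if \<exists>b. \<forall>S'. ?c k S' \<longrightarrow> \<not> sat ?M (s(n := a, y := b)) S' \<psi> then Some 0
        else None)" for k a
      by (simp add: step_def e \<phi>_eq \<psi>_eq)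
    have "decides (columns m X) e A"
    proof (rule computesI)
      fix a k v
      assume "step k (columns m X) e a = Some v"
      then show "v = of_bool (a \<in> A)"
        unfolding step A_def using c_S[of k] eq[of a] by (auto split: if_splits)
    next
      fix a
      show "\<exists>k. step k (columns m X) e a \<noteq> None"
      proof (cases "a \<in> A")
        case True
        then obtain b where b: "sat ?M (s(n := a, x := b)) S \<phi>" unfolding A_def by blast
        obtain N where N: "\<forall>S'. (\<forall>Z\<in>fvS \<phi>. \<forall>c<N. c \<in> S' Z \<longleftrightarrow> c \<in> S Z) \<longrightarrow>
            sat ?M (s(n := a, x := b)) S' \<phi> = sat ?M (s(n := a, x := b)) S \<phi>"
          using sat_Delta0_use[OF D(1), of S ?M] ..
        obtain k where "\<forall>S'. ?c k S' \<longrightarrow> (\<forall>Z\<in>V. \<forall>c<N. c \<in> S' Z \<longleftrightarrow> c \<in> S Z)" using c_below by blast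
        then have "\<forall>S'. ?c k S' \<longrightarrow> sat ?M (s(n := a, x := b)) S' \<phi>"
          using N b by (simp add: V_def)
        then have "step k (columns m X) e a \<noteq> None" unfolding step by auto
        then show ?thesis by blast
      next
        case False
        then obtain b where b: "\<not> sat ?M (s(n := a, y := b)) S \<psi>" using eq unfolding A_def by blast
        obtain N where N: "\<forall>S'. (\<forall>Z\<in>fvS \<psi>. \<forall>c<N. c \<in> S' Z \<longleftrightarrow> c \<in> S Z) \<longrightarrow>
            sat ?M (s(n := a, y := b)) S' \<psi> = sat ?M (s(n := a, y := b)) S \<psi>"
          using sat_Delta0_use[OF D(2), of S ?M] ..
        obtain k where "\<forall>S'. ?c k S' \<longrightarrow> (\<forall>Z\<in>V. \<forall>c<N. c \<in> S' Z \<longleftrightarrow> c \<in> S Z)" using c_below by blast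
        then have "\<forall>S'. ?c k S' \<longrightarrow> \<not> sat ?M (s(n := a, y := b)) S' \<psi>"
          using N b by (simp add: V_def)
        then have "step k (columns m X) e a \<noteq> None" unfolding step by auto
        then show ?thesis by blast
      qed
    qed
    then have "A \<in> ?M" unfolding sets_of_def by blast
    then show ?thesis by (intro bexI[of _ A]) (simp_all add: A_def)
  qed
  have indep: "sat ?M (s(n := a, x := b)) (S(W := A)) \<phi> = sat ?M (s(n := a, x := b)) S \<phi>" for s S a b A
    using W by (intro sat_cong) auto
  show ?thesis
    unfolding valid_def
  proof (intro allI impI)
    fix s and S :: "string \<Rightarrow> nat set"
    assume S: "range S \<subseteq> ?M"
    have "sat ?M s S (\<^bold>\<exists>\<^bold>S W. \<^bold>\<forall>n. Var n \<^bold>\<in> W \<^bold>\<longleftrightarrow> (\<^bold>\<exists>x. \<phi>))"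
      if iff: "sat ?M s S (\<^bold>\<forall>n. (\<^bold>\<exists>x. \<phi>) \<^bold>\<longleftrightarrow> (\<^bold>\<forall>y. \<psi>))"
    proof -
      have eq: "(\<exists>b. sat ?M (s(n := a, x := b)) S \<phi>) \<longleftrightarrow> (\<forall>b. sat ?M (s(n := a, y := b)) S \<psi>)" for a
        using iff unfolding sat.simps by blast
      obtain A where "A \<in> ?M" and A: "\<forall>a. a \<in> A \<longleftrightarrow> (\<exists>b. sat ?M (s(n := a, x := b)) S \<phi>)"
        by (rule bexE[OF main[OF S eq]])
      have "sat ?M s (S(W := A)) (\<^bold>\<forall>n. Var n \<^bold>\<in> W \<^bold>\<longleftrightarrow> (\<^bold>\<exists>x. \<phi>))"
        unfolding sat.simps val.simps fun_upd_same indep using A by blast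
      with \<open>A \<in> ?M\<close> show ?thesis unfolding sat.simps(4,7) by blast
    qed
    then show "sat ?M s S \<chi>" unfolding \<chi> sat.simps(5) by (rule impI)
  qed
qed

end

section \<open>Compactness of Cantor space\<close>

text \<open>Koenig's lemma for decreasing conditions \<open>R n\<close> that depend only on the part of the set below \<open>n\<close>: the
  set is built bit by bit, keeping \<open>Q k\<close>, which says that the bits chosen below \<open>k\<close> extend to a solution of
  every single condition.\<close>

lemma compactness:
  fixes R :: "nat \<Rightarrow> nat set \<Rightarrow> bool"
  assumes use: "\<And>n X Y. X \<inter> {..<n} = Y \<inter> {..<n} \<Longrightarrow> R n X \<Longrightarrow> R n Y"
    and anti: "\<And>n X. R (Suc n) X \<Longrightarrow> R n X"
    and ex: "\<And>n. \<exists>X. R n X"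
  shows "\<exists>X. \<forall>n. R n X"
proof -
  define Q where "Q k S \<longleftrightarrow> (\<forall>n. \<exists>X. R n X \<and> X \<inter> {..<k} = S)" for k S
  have anti': "R n X" if "R n' X" "n \<le> n'" for n n' X
    using that(2,1) by (induction rule: inc_induct) (use anti in blast)+
  have Q_step: "Q (Suc k) S \<or> Q (Suc k) (insert k S)" if Q: "Q k S" for k S
  proof (rule ccontr)
    assume "\<not> ?thesis"
    then obtain n n' where n: "\<And>X. R n X \<Longrightarrow> X \<inter> {..<Suc k} \<noteq> S"
      and n': "\<And>X. R n' X \<Longrightarrow> X \<inter> {..<Suc k} \<noteq> insert k S"
      unfolding Q_def by blast
    obtain X where "R (max n n') X" and X: "X \<inter> {..<k} = S"
      using Q unfolding Q_def by blast
    then have "R n X" "R n' X" using anti' by (meson max.cobounded1 max.cobounded2)+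
    moreover have "X \<inter> {..<Suc k} = (if k \<in> X then insert k S else S)"
      using X by (auto simp: lessThan_Suc)
    ultimately show False using n n' by (metis (full_types))
  qed
  define D where "D = rec_nat {} (\<lambda>k S. if Q (Suc k) (insert k S) then insert k S else S)"
  have D_Suc: "D (Suc k) = (if Q (Suc k) (insert k (D k)) then insert k (D k) else D k)" for k
    by (simp add: D_def)
  have Q: "Q k (D k)" for k
  proof (induction k)
    case 0
    show ?case using ex by (simp add: Q_def D_def)
  next
    case (Suc k)
    then show ?case using Q_step[of k "D k"] by (auto simp: D_Suc)
  qed
  have bound: "D k \<subseteq> {..<k}" for k
    using Q[of k] unfolding Q_def by blast
  have D_mono: "D k \<subseteq> D n" if "k \<le> n" for k n
    using that by (induction rule: dec_induct) (auto simp: D_Suc)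
  have D_stable: "D n \<inter> {..<k} = D k" if "k \<le> n" for k n
    using that
  proof (induction rule: dec_induct)
    case base
    then show ?case using bound by blast
  next
    case (step n)
    then show ?case by (auto simp: D_Suc)
  qed
  have "(\<Union>n. D n) \<inter> {..<k} = D k" for k
  proof
    show "(\<Union>n. D n) \<inter> {..<k} \<subseteq> D k"
    proof
      fix c
      assume "c \<in> (\<Union>n. D n) \<inter> {..<k}"
      then obtain n where "c \<in> D n" "c < k" by blast
      then have "c \<in> D (max n k) \<inter> {..<k}" using D_mono[of n "max n k"] by auto
      then show "c \<in> D k" using D_stable[of k "max n k"] by simp
    qed
  qed (use bound in blast)
  moreover have "\<exists>X. R k X \<and> X \<inter> {..<k} = D k" for k
    using Q[of k] unfolding Q_def by blast
  ultimately have "R k (\<Union>n. D n)" for k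
    using use by metis
  then show ?thesis by blast
qed

section \<open>Scott sets\<close>

definition in_tree :: "table \<Rightarrow> nat set \<Rightarrow> nat \<Rightarrow> bool list \<Rightarrow> bool" where
  "in_tree E Y e \<sigma> \<longleftrightarrow> (\<forall>i\<le>length \<sigma>. E Y e (str_code (take i \<sigma>)) = Some 1)"

text \<open>Program \<open>e\<close> has decided all strings of length at most \<open>l\<close>, and the tree that it describes reaches
  level \<open>l\<close>. Requiring every prefix of a string to be accepted turns an arbitrary program into one that
  describes a tree.\<close>

definition active :: "table \<Rightarrow> nat set \<Rightarrow> nat \<Rightarrow> nat \<Rightarrow> bool" where
  "active E Y e l \<longleftrightarrow> (\<forall>\<sigma>. length \<sigma> \<le> l \<longrightarrow> E Y e (str_code \<sigma>) \<noteq> None) \<and>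
    (\<exists>\<sigma>. length \<sigma> = l \<and> in_tree E Y e \<sigma>)"

text \<open>Column \<open>m\<close> is divided into infinitely many rows; row \<open>e\<close> is reserved for a path through the tree
  that program \<open>e\<close> decides from the columns before \<open>m\<close>.\<close>

definition cell :: "nat \<Rightarrow> nat \<Rightarrow> nat \<Rightarrow> nat" where
  "cell m e j = prod_encode (m, prod_encode (e, j))"

definition branch :: "nat set \<Rightarrow> nat \<Rightarrow> nat \<Rightarrow> nat \<Rightarrow> bool" where
  "branch X m e j \<longleftrightarrow> cell m e j \<in> X"

definition initial :: "(nat \<Rightarrow> bool) \<Rightarrow> nat \<Rightarrow> bool list" where
  "initial b l = map b [0..<l]"

text \<open>The tree of a program is not known to be infinite at any stage. The condition therefore only asks
  that the branch follow the tree as far as the tree is known to reach; the restriction to cells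
  below \<open>n\<close> makes it a condition on the part of \<open>X\<close> below \<open>n\<close>.\<close>

definition scott :: "table \<Rightarrow> nat \<Rightarrow> nat set \<Rightarrow> bool" where
  "scott E n X \<longleftrightarrow> (\<forall>m e l. (\<forall>j<l. cell m e j < n) \<longrightarrow> active E (columns m X) e l \<longrightarrow>
    in_tree E (columns m X) e (initial (branch X m e) l))"

lemma initial_cong: "(\<And>j. j < l \<Longrightarrow> b j = b' j) \<Longrightarrow> initial b l = initial b' l"
  by (simp add: initial_def)

lemma length_initial [simp]: "length (initial b l) = l"
  by (simp add: initial_def)

lemma columns_agree: "X \<inter> {..<n} = Y \<inter> {..<n} \<Longrightarrow> columns m X \<inter> {..<n} = columns m Y \<inter> {..<n}"
  by (simp flip: columns_Int)

text \<open>Reads the graph of the branch off the oracle, waiting until all cells that matter for \<open>y\<close> are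
  available; \<open>y = cpair j v\<close> implies \<open>j \<le> y\<close>.\<close>

fun path_op :: "nat \<times> nat \<Rightarrow> oper" where
  "path_op (m, e) k H X y =
    (if \<forall>j\<le>y. cell m e j < k then Some (of_bool (\<exists>j. y = cpair j (of_bool (branch X m e j)))) else None)"

context machine
begin

lemma in_tree_stable:
  assumes "in_tree (ev n) Y e \<sigma>" "\<And>\<tau>. length \<tau> \<le> length \<sigma> \<Longrightarrow> ev n' Y e (str_code \<tau>) \<noteq> None"
  shows "in_tree (ev n') Y e \<sigma>"
  unfolding in_tree_def
proof (intro allI impI)
  fix i
  assume i: "i \<le> length \<sigma>"
  then obtain y where "ev n' Y e (str_code (take i \<sigma>)) = Some y"
    using assms(2)[of "take i \<sigma>"] by auto
  moreover have "ev n Y e (str_code (take i \<sigma>)) = Some 1"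
    using assms(1) i unfolding in_tree_def by blast
  ultimately show "ev n' Y e (str_code (take i \<sigma>)) = Some 1"
    using ev_unique by blast
qed

lemma in_tree_mono: "in_tree (ev n) Y e \<sigma> \<Longrightarrow> n \<le> n' \<Longrightarrow> in_tree (ev n') Y e \<sigma>"
  unfolding in_tree_def using ev_mono by blast

lemma active_mono:
  assumes "active (ev n) Y e l" "n \<le> n'"
  shows "active (ev n') Y e l"
proof -
  have "ev n' Y e (str_code \<sigma>) \<noteq> None" if "length \<sigma> \<le> l" for \<sigma>
    using assms that unfolding active_def by (metis ev_mono not_None_eq)
  then show ?thesis
    using assms in_tree_mono unfolding active_def by blast
qed

lemma scott_use:
  assumes eq: "X \<inter> {..<n} = Y \<inter> {..<n}" and X: "scott (ev n) n X"
  shows "scott (ev n) n Y"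
  unfolding scott_def
proof (intro allI impI)
  fix m e l
  assume l: "\<forall>j<l. cell m e j < n" and a: "active (ev n) (columns m Y) e l"
  have ev: "ev n (columns m X) = ev n (columns m Y)"
    by (rule ev_use) (rule columns_agree[OF eq])
  have "active (ev n) (columns m X) e l"
    using a unfolding active_def in_tree_def ev .
  with l have "in_tree (ev n) (columns m X) e (initial (branch X m e) l)"
    using X unfolding scott_def by blast
  moreover have "initial (branch X m e) l = initial (branch Y m e) l"
    unfolding branch_def using l eq by (intro initial_cong) blast
  ultimately show "in_tree (ev n) (columns m Y) e (initial (branch Y m e) l)"
    by (simp add: in_tree_def ev)
qed

lemma scott_antimono:
  assumes "scott (ev n') n' X" "n \<le> n'"
  shows "scott (ev n) n X"
  unfolding scott_def
proof (intro allI impI)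
  fix m e l
  assume l: "\<forall>j<l. cell m e j < n" and a: "active (ev n) (columns m X) e l"
  have "in_tree (ev n') (columns m X) e (initial (branch X m e) l)"
    using assms l active_mono[OF a assms(2)] unfolding scott_def by (meson order_less_le_trans)
  then show "in_tree (ev n) (columns m X) e (initial (branch X m e) l)"
    by (rule in_tree_stable) (use a in \<open>simp add: active_def\<close>)
qed

text \<open>By compactness, it suffices to follow the tree up to level \<open>k\<close>. Take a string of the tree at the
  largest level up to \<open>k\<close> that is ever known to be reached; its prefixes serve the smaller levels.\<close>

lemma branch_exists:
  "\<exists>S. \<forall>n l. active (ev n) Y e l \<longrightarrow> in_tree (ev n) Y e (initial (\<lambda>j. j \<in> S) l)"
proof -
  define R where "R k S \<longleftrightarrow> (\<forall>l\<le>k. \<forall>n. active (ev n) Y e l \<longrightarrow> in_tree (ev n) Y e (initial (\<lambda>j. j \<in> S) l))"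
    for k S
  have "\<exists>S. \<forall>k. R k S"
  proof (rule compactness)
    fix n S S'
    assume eq: "S \<inter> {..<n} = S' \<inter> {..<n}" and R: "R n S"
    have "j \<in> S \<longleftrightarrow> j \<in> S'" if "j < n" for j
      using eq that by blast
    then have init: "initial (\<lambda>j. j \<in> S) l = initial (\<lambda>j. j \<in> S') l" if "l \<le> n" for l
      using that by (intro initial_cong) (meson order_less_le_trans)
    show "R n S'"
      unfolding R_def
    proof (intro allI impI)
      fix l n'
      assume "l \<le> n" "active (ev n') Y e l"
      then show "in_tree (ev n') Y e (initial (\<lambda>j. j \<in> S') l)"
        using R init[of l] unfolding R_def by metis
    qed
  next
    show "R n S" if "R (Suc n) S" for n S
      using that unfolding R_def by simp
  next
    fix k
    show "\<exists>S. R k S"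
    proof (cases "\<exists>l\<le>k. \<exists>n. active (ev n) Y e l")
      case False
      then show ?thesis unfolding R_def by blast
    next
      case True
      define L where "L = {l. l \<le> k \<and> (\<exists>n. active (ev n) Y e l)}"
      have L: "finite L" "L \<noteq> {}" using True unfolding L_def by auto
      then have "Max L \<in> L" by simp
      then obtain n \<sigma> where \<sigma>: "length \<sigma> = Max L" "in_tree (ev n) Y e \<sigma>"
        unfolding L_def active_def by blast
      define S where "S = {j. j < length \<sigma> \<and> \<sigma> ! j}"
      have "in_tree (ev n') Y e (initial (\<lambda>j. j \<in> S) l)" if "l \<le> k" "active (ev n') Y e l" for l n'
      proof -
        have "l \<le> length \<sigma>" using that L(1) \<sigma>(1) unfolding L_def by (auto intro!: Max_ge)
        then have eq: "initial (\<lambda>j. j \<in> S) l = take l \<sigma>"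
          by (intro nth_equalityI) (auto simp: initial_def S_def)
        have "in_tree (ev n) Y e (take l \<sigma>)"
          using \<sigma>(2) \<open>l \<le> length \<sigma>\<close> unfolding in_tree_def by (auto simp: min_absorb1)
        then show ?thesis
          unfolding eq by (rule in_tree_stable) (use that(2) \<open>l \<le> length \<sigma>\<close> in \<open>simp add: active_def\<close>)
      qed
      then show ?thesis unfolding R_def by blast
    qed
  qed
  then show ?thesis unfolding R_def by (meson order_refl)
qed

text \<open>The columns are filled one after another, since the trees to be followed by column \<open>m\<close> depend on the
  columns before \<open>m\<close> only.\<close>

lemma scott_exists: "\<exists>X. \<forall>n. scott (ev n) n X"
proof -
  obtain pick where pick: "\<And>Y e n l. active (ev n) Y e l \<Longrightarrow> in_tree (ev n) Y e (initial (\<lambda>j. j \<in> pick Y e) l)"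
    using branch_exists by metis
  define C where "C = rec_nat {} (\<lambda>m Y. Y \<union> {cell m e j | e j. j \<in> pick Y e})"
  have C_Suc: "C (Suc m) = C m \<union> {cell m e j | e j. j \<in> pick (C m) e}" for m
    by (simp add: C_def)
  have C_iff: "cell k e j \<in> C m \<longleftrightarrow> k < m \<and> j \<in> pick (C k) e" for k e j m
  proof (induction m)
    case (Suc m)
    then show ?case by (auto simp: C_Suc cell_def less_Suc_eq)
  qed (simp add: C_def)
  define X where "X = (\<Union>m. C m)"
  have X_iff: "cell k e j \<in> X \<longleftrightarrow> j \<in> pick (C k) e" for k e j
    unfolding X_def using C_iff by auto
  have "columns m X = C m" for m
  proof (rule set_eqI)
    fix c
    obtain k e j where c: "c = cell k e j"
      unfolding cell_def by (metis prod_decode_inverse surj_pair)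
    show "c \<in> columns m X \<longleftrightarrow> c \<in> C m"
      unfolding c columns_def C_iff using X_iff by (auto simp: cell_def)
  qed
  moreover have "branch X m e = (\<lambda>j. j \<in> pick (C m) e)" for m e
    by (simp add: branch_def X_iff fun_eq_iff)
  ultimately have "scott (ev n) n X" for n
    unfolding scott_def using pick by simp
  then show ?thesis by blast
qed

lemma valid_WKL_sets_of:
  assumes ops: "range path_op \<subseteq> range ops" and scott: "\<And>n. scott (ev n) n X"
  shows "valid (sets_of X) WKL"
proof (rule valid_WKL_if_paths)
  fix T
  assume "T \<in> sets_of X" and levels: "\<And>l. \<exists>\<sigma>. length \<sigma> = l \<and> str_code \<sigma> \<in> T"
    and closed: "\<And>\<sigma> i. str_code \<sigma> \<in> T \<Longrightarrow> str_code (take i \<sigma>) \<in> T"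
  then obtain m e where T: "decides (columns m X) e T" unfolding sets_of_def by blast
  have "str_code (initial (branch X m e) l) \<in> T" for l
  proof -
    have "finite {\<sigma>::bool list. length \<sigma> \<le> l}"
      using finite_lists_length_le[of "UNIV :: bool set" l] by simp
    then have "finite (str_code ` {\<sigma>. length \<sigma> \<le> l})" by simp
    then obtain N where N: "\<And>\<sigma>. length \<sigma> \<le> l \<Longrightarrow> str_code \<sigma> < N"
      unfolding finite_nat_set_iff_bounded by auto
    obtain n where n: "\<And>k \<sigma>. k \<ge> n \<Longrightarrow> length \<sigma> \<le> l \<Longrightarrow>
        ev k (columns m X) e (str_code \<sigma>) = Some (of_bool (str_code \<sigma> \<in> T))"
      using computes_below[OF T] N by blast
    have "finite (cell m e ` {..<l})" by simp
    then obtain n' where n': "\<And>j. j < l \<Longrightarrow> cell m e j < n'"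
      unfolding finite_nat_set_iff_bounded by auto
    define k where "k = max n n'"
    have k: "n \<le> k" "\<forall>j<l. cell m e j < k"
      using n' unfolding k_def by (auto simp: less_max_iff_disj)
    obtain \<sigma> where \<sigma>: "length \<sigma> = l" "str_code \<sigma> \<in> T" using levels by blast
    have "in_tree (ev k) (columns m X) e \<sigma>"
      unfolding in_tree_def using n[OF k(1)] \<sigma> closed[OF \<sigma>(2)] by simp
    with \<sigma> have "active (ev k) (columns m X) e l"
      unfolding active_def using n[OF k(1)] by auto
    then have "in_tree (ev k) (columns m X) e (initial (branch X m e) l)"
      using scott[of k] k(2) unfolding scott_def by blast
    then have "ev k (columns m X) e (str_code (initial (branch X m e) l)) = Some 1"
      unfolding in_tree_def by (metis length_initial order_refl take_all)
    then show ?thesis using n[OF k(1), of "initial (branch X m e) l"]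
      by (cases "str_code (initial (branch X m e) l) \<in> T") auto
  qed
  moreover have "{cpair j (of_bool (branch X m e j)) | j. True} \<in> sets_of X" (is "?F \<in> _")
  proof -
    obtain i where i: "ops i = path_op (m, e)" using op_index[OF ops] by blast
    have br: "branch (columns (Suc m) X \<inter> {..<k}) m e j \<longleftrightarrow> branch X m e j" if "cell m e j < k" for j k
      using that by (simp add: branch_def columns_def cell_def)
    have le: "j \<le> cpair j v" for j v by (simp add: cpair_def)
    have step: "step k (columns (Suc m) X) i y =
        (if \<forall>j\<le>y. cell m e j < k then Some (of_bool (y \<in> ?F)) else None)" for k y
    proof (cases "\<forall>j\<le>y. cell m e j < k")
      case True
      then have "(\<exists>j. y = cpair j (of_bool (branch (columns (Suc m) X \<inter> {..<k}) m e j))) \<longleftrightarrow> y \<in> ?F"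
      proof -
        have "y = cpair j (of_bool (branch (columns (Suc m) X \<inter> {..<k}) m e j)) \<longleftrightarrow>
            y = cpair j (of_bool (branch X m e j))" for j
          using True br[of j k] le[of j] by (cases "j \<le> y") auto
        then show ?thesis by simp
      qed
      then show ?thesis using True by (simp only: step_def i path_op.simps if_True simp_thms)
    next
      case False
      then show ?thesis by (simp only: step_def i path_op.simps if_False)
    qed
    have "decides (columns (Suc m) X) i ?F"
    proof (rule computesI)
      fix y
      have "finite (cell m e ` {..y})" by simp
      then obtain k where "\<And>j. j \<le> y \<Longrightarrow> cell m e j < k"
        unfolding finite_nat_set_iff_bounded by auto
      then show "\<exists>k. step k (columns (Suc m) X) i y \<noteq> None" unfolding step by auto
    qed (auto simp: step split: if_splits)
    then show ?thesis unfolding sets_of_def by blast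
  qed
  ultimately show "\<exists>b. (\<forall>l. str_code (map b [0..<l]) \<in> T) \<and> {cpair j (of_bool (b j)) | j. True} \<in> sets_of X"
    unfolding initial_def by blast
qed

end

section \<open>The hyperimmune-free basis theorem\<close>

text \<open>The list \<open>L\<close> contains computations that are forced to diverge.\<close>

definition allowed :: "table \<Rightarrow> nat \<Rightarrow> (nat \<times> nat) list \<Rightarrow> nat set \<Rightarrow> bool" where
  "allowed E n L X \<longleftrightarrow> scott E n X \<and> (\<forall>(e, x)\<in>set L. E X e x = None)"

text \<open>Once every allowed oracle makes program \<open>e\<close> converge at \<open>x\<close>, the largest value that occurs is an
  oracle-free bound. It is finite because only the part of the oracle below \<open>k\<close> matters.\<close>

fun bound_op :: "(nat \<times> nat) list \<times> nat \<Rightarrow> oper" where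
  "bound_op (L, e) k H X x =
    (if \<forall>S. allowed (H k) k L S \<longrightarrow> H k S e x \<noteq> None
     then Some (Max (insert 0 {y. \<exists>S. allowed (H k) k L S \<and> H k S e x = Some y})) else None)"

context machine
begin

lemma allowed_use:
  assumes "X \<inter> {..<n} = Y \<inter> {..<n}" "allowed (ev n) n L X"
  shows "allowed (ev n) n L Y"
  using assms(2) scott_use[OF assms(1)] unfolding allowed_def ev_use[OF assms(1)] by blast

lemma ev_None: "ev n X e x = None \<Longrightarrow> k \<le> n \<Longrightarrow> ev k X e x = None"
proof (rule ccontr)
  assume none: "ev n X e x = None" and "k \<le> n" "ev k X e x \<noteq> None"
  then obtain y where "ev k X e x = Some y" by blast
  from ev_mono[OF this \<open>k \<le> n\<close>] none show False by simp
qed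

lemma allowed_antimono:
  assumes "allowed (ev n') n' L' X" "n \<le> n'" "set L \<subseteq> set L'"
  shows "allowed (ev n) n L X"
  unfolding allowed_def
proof (intro conjI ballI)
  show "scott (ev n) n X"
    using assms(1) scott_antimono[OF _ assms(2)] unfolding allowed_def by blast
  fix p
  assume "p \<in> set L"
  then have "case p of (e, x) \<Rightarrow> ev n' X e x = None"
    using assms unfolding allowed_def by blast
  then show "case p of (e, x) \<Rightarrow> ev n X e x = None"
    using ev_None[OF _ assms(2)] by (cases p) simp
qed

text \<open>Forcing with effectively closed classes: program \<open>e\<close> is made to diverge at some input if the class
  fixed so far allows this (\<open>Ls\<close> lists the choices made). Otherwise, for every input, the program
  converges on the whole class, by compactness already at some finite stage, and \<open>bound_op\<close> computes a
  bound.\<close>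

theorem hyperimmune_free_basis:
  assumes ops: "range bound_op \<subseteq> range ops"
  shows "\<exists>X. (\<forall>n. scott (ev n) n X) \<and>
    (\<forall>e f. computes X e f \<longrightarrow> (\<exists>i h. computes {} i h \<and> (\<forall>x. f x \<le> h x)))"
proof -
  define con where "con L \<longleftrightarrow> (\<forall>n. \<exists>X. allowed (ev n) n L X)" for L
  define Ls where "Ls = rec_nat [] (\<lambda>e L. if \<exists>x. con ((e, x) # L) then (e, SOME x. con ((e, x) # L)) # L else L)"
  have Ls_Suc: "Ls (Suc e) = (if \<exists>x. con ((e, x) # Ls e) then (e, SOME x. con ((e, x) # Ls e)) # Ls e else Ls e)" for e
    by (simp add: Ls_def)
  have con: "con (Ls e)" for e
  proof (induction e)
    case 0
    show ?case using scott_exists by (auto simp: con_def Ls_def allowed_def)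
  next
    case (Suc e)
    then show ?case using someI_ex[of "\<lambda>x. con ((e, x) # Ls e)"] by (simp add: Ls_Suc)
  qed
  have Ls_mono: "set (Ls k) \<subseteq> set (Ls n)" if "k \<le> n" for k n
    using that by (induction rule: dec_induct) (auto simp: Ls_Suc)
  have "\<exists>X. \<forall>n. allowed (ev n) n (Ls n) X"
  proof (rule compactness)
    show "\<exists>X. allowed (ev n) n (Ls n) X" for n using con unfolding con_def by blast
    show "allowed (ev n) n (Ls n) X" if "allowed (ev (Suc n)) (Suc n) (Ls (Suc n)) X" for n X
      using allowed_antimono[OF that] Ls_mono by simp
  qed (rule allowed_use)
  then obtain X where X': "\<And>n. allowed (ev n) n (Ls n) X" by blast
  have X: "allowed (ev n) n (Ls k) X" for n k
    using allowed_antimono[OF X'[of "max n k"], of n "Ls k"] Ls_mono[of k "max n k"] by simp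
  have "\<exists>i h. computes {} i h \<and> (\<forall>x. f x \<le> h x)" if f: "computes X e f" for e f
  proof -
    have "\<not> con ((e, x) # Ls e)" for x
    proof
      assume "con ((e, x) # Ls e)"
      then have "\<exists>x. con ((e, x) # Ls e)" by blast
      then obtain z where "(e, z) \<in> set (Ls (Suc e))" by (metis Ls_Suc list.set_intros(1))
      then have none: "ev n X e z = None" for n using X[of n "Suc e"] unfolding allowed_def by blast
      obtain n where "ev n X e z = Some (f z)" using f unfolding computes_def by blast
      then show False by (simp add: none)
    qed
    then have "\<exists>n. \<forall>S. \<not> allowed (ev n) n ((e, x) # Ls e) S" for x
      unfolding con_def by blast
    moreover have "allowed (ev n) n ((e, x) # Ls e) S \<longleftrightarrow> allowed (ev n) n (Ls e) S \<and> ev n S e x = None" for n x S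
      by (auto simp: allowed_def)
    ultimately obtain st where st: "\<And>x S. allowed (ev (st x)) (st x) (Ls e) S \<Longrightarrow> ev (st x) S e x \<noteq> None" by metis
    obtain i where i: "ops i = bound_op (Ls e, e)" using op_index[OF ops] by blast
    have "\<exists>y. (\<exists>n. ev n {} i x = Some y) \<and> f x \<le> y" for x
    proof -
      have "step (st x) {} i x \<noteq> None" using st by (simp add: step_def i)
      then obtain n y where y: "ev n {} i x = Some y" using step_converges by blast
      then obtain k where k: "step k {} i x = Some y" using ev_from_step by blast
      let ?Y = "{y. \<exists>S. allowed (ev k) k (Ls e) S \<and> ev k S e x = Some y}"
      have conv: "\<forall>S. allowed (ev k) k (Ls e) S \<longrightarrow> ev k S e x \<noteq> None" and Max: "y = Max (insert 0 ?Y)"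
        using k by (auto simp: step_def i split: if_splits)
      have "?Y \<subseteq> (\<lambda>S. the (ev k S e x)) ` Pow {..<k}"
      proof
        fix z
        assume "z \<in> ?Y"
        then obtain S where "ev k S e x = Some z" by blast
        then have "z = the (ev k (S \<inter> {..<k}) e x)" by (simp add: ev_Int)
        then show "z \<in> (\<lambda>S. the (ev k S e x)) ` Pow {..<k}" by blast
      qed
      then have "finite ?Y" by (rule finite_subset) simp
      moreover obtain z where "ev k X e x = Some z" using conv X by blast
      moreover then have "z = f x" using computes_ev[OF f] by blast
      ultimately have "f x \<le> y" unfolding Max using X by (intro Max_ge) auto
      with y show ?thesis by blast
    qed
    then obtain h where "\<And>x. \<exists>n. ev n {} i x = Some (h x)" "\<And>x. f x \<le> h x" by metis
    then show ?thesis unfolding computes_def by blast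
  qed
  moreover have "scott (ev n) n X" for n using X unfolding allowed_def by blast
  ultimately show ?thesis by blast
qed

end

section \<open>A family without small maximal subfamilies\<close>

text \<open>Any measure would do that grows strictly along prefixes and can be made as large as desired by
  appending a single number.\<close>

definition weight :: "nat list \<Rightarrow> nat" where
  "weight u = sum_list u + length u"

text \<open>Converging on all inputs up to \<open>m\<close> makes the condition monotone in \<open>m\<close>. Demanding \<open>y < t\<close> makes \<open>t\<close> a strict upper
  bound of the values.\<close>

definition conv :: "(nat \<Rightarrow> table) \<Rightarrow> nat \<Rightarrow> nat \<Rightarrow> nat \<Rightarrow> bool" where
  "conv H e m t \<longleftrightarrow> (\<forall>x\<le>m. \<exists>y<t. H t {} e x = Some y)"

text \<open>A witness node for \<open>e\<close> and \<open>v\<close> releases its extension \<open>u\<close>. In the second case the step from \<open>take i u\<close> to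
  \<open>take (Suc i) u\<close> outweighs the computation of \<open>e\<close> up to the weight of \<open>take i u\<close>, which is decidable from
  \<open>u\<close> and hence does not involve \<open>t\<close>.\<close>

definition released :: "(nat \<Rightarrow> table) \<Rightarrow> nat \<Rightarrow> nat list \<Rightarrow> nat list \<Rightarrow> nat \<Rightarrow> bool" where
  "released H e v u t \<longleftrightarrow> conv H e (weight u) t \<or>
    (\<exists>i. length v \<le> i \<and> i < length u \<and> conv H e (weight (take i u)) (weight (take (Suc i) u)))"

definition label :: "nat \<Rightarrow> nat" where
  "label a = fst (prod_decode a) - 1"

definition stage :: "nat \<Rightarrow> nat" where
  "stage a = fst (prod_decode (snd (prod_decode a)))"

definition str :: "nat \<Rightarrow> nat list" where
  "str a = list_decode (snd (prod_decode (snd (prod_decode a))))"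

text \<open>A node is a triple of a kind, a stage and a string. Kind \<open>0\<close> is a string node, and kind \<open>e + 1\<close> a witness
  node for program \<open>e\<close> if its stage certifies that the program has converged up to the weight of the
  string. Without this certificate, a witness node for a diverging program could lie in a finite maximal clique.
  For the same reason \<open>e\<close> is bounded by the weight: only finitely many programs have witness nodes
  at a given string, and one heavy step can satisfy them all. All other nodes behave like string nodes,
  so every number is a node.\<close>

definition witness :: "(nat \<Rightarrow> table) \<Rightarrow> nat \<Rightarrow> bool" where
  "witness H a \<longleftrightarrow> 0 < fst (prod_decode a) \<and> label a \<le> weight (str a) \<and>
    conv H (label a) (weight (str a)) (stage a)"

text \<open>The node \<open>a\<close> is joined, by stage \<open>t\<close>, to the string \<open>u\<close>.\<close>

definition near :: "(nat \<Rightarrow> table) \<Rightarrow> nat \<Rightarrow> nat \<Rightarrow> nat list \<Rightarrow> bool" where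
  "near H t a u \<longleftrightarrow> prefix u (str a) \<or>
    strict_prefix (str a) u \<and> (witness H a \<longrightarrow> released H (label a) (str a) u t)"

text \<open>A node behaves towards others as its string does, except that a witness node may withhold consent
  to longer strings.\<close>

definition adj :: "(nat \<Rightarrow> table) \<Rightarrow> nat \<Rightarrow> nat \<Rightarrow> nat \<Rightarrow> bool" where
  "adj H t a b \<longleftrightarrow> near H t a (str b) \<and> near H t b (str a)"

text \<open>Even numbers are private elements, which make the sets nonempty and pairwise distinct; the odd number
  coding \<open>t, b, c\<close> is a common element of the sets of \<open>b\<close> and \<open>c\<close>, provided that these are joined by stage \<open>t\<close>.
  Membership is decidable although adjacency is only enumerable.\<close>

definition member :: "(nat \<Rightarrow> table) \<Rightarrow> nat \<Rightarrow> nat \<Rightarrow> bool" where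
  "member H a x \<longleftrightarrow> x = 2 * a \<or>
    (\<exists>t b c. x = 2 * prod_encode (t, prod_encode (b, c)) + 1 \<and> (a = b \<or> a = c) \<and> adj H t b c)"

definition family :: "(nat \<Rightarrow> table) \<Rightarrow> nat set" where
  "family H = {cpair a x | a x. member H a x}"

lemma cpair_in_family [simp]: "cpair a x \<in> family H \<longleftrightarrow> member H a x"
  by (simp add: family_def)

definition string_node :: "nat list \<Rightarrow> nat" where
  "string_node v = prod_encode (0, prod_encode (0, list_encode v))"

definition witness_node :: "nat \<Rightarrow> nat list \<Rightarrow> nat \<Rightarrow> nat" where
  "witness_node e v s = prod_encode (Suc e, prod_encode (s, list_encode v))"

lemma string_node_simps [simp]: "str (string_node v) = v" "\<not> witness H (string_node v)"
  by (simp_all add: string_node_def str_def witness_def)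

lemma witness_node_simps [simp]:
  "str (witness_node e v s) = v" "label (witness_node e v s) = e" "stage (witness_node e v s) = s"
  "witness H (witness_node e v s) \<longleftrightarrow> e \<le> weight v \<and> conv H e (weight v) s"
  by (simp_all add: witness_node_def str_def label_def stage_def witness_def)

lemma weight_prefix: "prefix u v \<Longrightarrow> weight u \<le> weight v"
  by (auto simp: weight_def prefix_def)

lemma weight_strict_prefix: "strict_prefix u v \<Longrightarrow> weight u < weight v"
  by (auto simp: weight_def strict_prefix_def prefix_def)

lemma weight_take: "weight (take i u) \<le> weight u"
  by (intro weight_prefix take_is_prefix)

lemma conv_history: "t \<le> k \<Longrightarrow> conv (history k H) e m t \<longleftrightarrow> conv H e m t"
  by (simp add: conv_def)

lemma released_history:
  assumes "t \<le> k" "weight u \<le> k"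
  shows "released (history k H) e v u t \<longleftrightarrow> released H e v u t"
proof -
  have "conv (history k H) e m (weight (take i u)) \<longleftrightarrow> conv H e m (weight (take i u))" for m i
    using weight_take[of i u] assms(2) by (intro conv_history) simp
  then show ?thesis by (simp add: released_def conv_history assms(1))
qed

lemma witness_history: "stage a \<le> k \<Longrightarrow> witness (history k H) a \<longleftrightarrow> witness H a"
  by (simp add: witness_def conv_history)

text \<open>The graph up to stage \<open>k\<close> is determined by the tables up to stage \<open>k\<close>, as long as the nodes involved are
  small; an operation can therefore inspect it.\<close>

lemma adj_history:
  assumes "t \<le> k" "stage a \<le> k" "stage b \<le> k" "weight (str a) \<le> k" "weight (str b) \<le> k"
  shows "adj (history k H) t a b \<longleftrightarrow> adj H t a b"
  using assms by (simp add: adj_def near_def witness_history released_history)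

lemma adj_commute: "adj H t a b \<longleftrightarrow> adj H t b a"
  by (auto simp: adj_def)

lemma member_private [simp]: "member H a (2 * b) \<longleftrightarrow> a = b"
proof -
  have "2 * b \<noteq> 2 * k + 1" for k by presburger
  then show ?thesis unfolding member_def by auto
qed

lemma member_both:
  assumes "member H a x" "member H b x" "a \<noteq> b"
  shows "\<exists>t. adj H t a b"
proof -
  have "x \<noteq> 2 * a" "x \<noteq> 2 * b" using assms by auto
  then obtain t c d t' c' d' where
    "x = 2 * prod_encode (t, prod_encode (c, d)) + 1" "a = c \<or> a = d" "adj H t c d"
    "x = 2 * prod_encode (t', prod_encode (c', d')) + 1" "b = c' \<or> b = d'"
    using assms unfolding member_def by blast
  then have "b = c \<or> b = d" by simp
  with \<open>a = c \<or> a = d\<close> \<open>adj H t c d\<close> \<open>a \<noteq> b\<close> show ?thesis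
    using adj_commute by blast
qed

lemma adj_member:
  assumes "adj H t a b"
  shows "\<exists>x. member H a x \<and> member H b x"
  using assms unfolding member_def by blast

definition sub :: "nat set \<Rightarrow> nat set \<Rightarrow> bool" where
  "sub B A \<longleftrightarrow> (\<forall>i. \<exists>j. \<forall>x. cpair i x \<in> B \<longleftrightarrow> cpair j x \<in> A)"

definition d2 :: "nat set \<Rightarrow> bool" where
  "d2 B \<longleftrightarrow> (\<forall>i j. \<not> (\<forall>x. cpair i x \<in> B \<longleftrightarrow> cpair j x \<in> B) \<longrightarrow> (\<exists>x. cpair i x \<in> B \<and> cpair j x \<in> B))"

subsection \<open>Maximal cliques\<close>

context machine
begin

lemma conv_mono: "conv ev e m t \<Longrightarrow> m' \<le> m \<Longrightarrow> t \<le> t' \<Longrightarrow> conv ev e m' t'"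
  unfolding conv_def by (meson ev_mono le_trans less_le_trans)

lemma released_mono: "released ev e v u t \<Longrightarrow> t \<le> t' \<Longrightarrow> released ev e v u t'"
  unfolding released_def using conv_mono by blast

lemma adj_mono: "adj ev t a b \<Longrightarrow> t \<le> t' \<Longrightarrow> adj ev t' a b"
  unfolding adj_def near_def using released_mono by blast

text \<open>Either the step that released \<open>w\<close> lies within \<open>u\<close>, or \<open>u\<close> is a prefix of the string where that step started, and then
  the program has converged up to the weight of \<open>u\<close>.\<close>

lemma released_prefix:
  assumes released: "released ev e v w t" and "prefix u w"
  shows "\<exists>t. released ev e v u t"
  using released unfolding released_def[of _ _ _ w]
proof (elim disjE exE conjE)
  assume "conv ev e (weight w) t"
  then show ?thesis
    using conv_mono weight_prefix[OF \<open>prefix u w\<close>] unfolding released_def by blast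
next
  fix i
  assume i: "length v \<le> i" "i < length w" "conv ev e (weight (take i w)) (weight (take (Suc i) w))"
  obtain r where w: "w = u @ r" using \<open>prefix u w\<close> by (auto simp: prefix_def)
  show ?thesis
  proof (cases "i < length u")
    case True
    then have "take i w = take i u" "take (Suc i) w = take (Suc i) u" by (simp_all add: w)
    with i True show ?thesis unfolding released_def by auto
  next
    case False
    then have "weight u \<le> weight (take i w)" by (intro weight_prefix) (simp add: w)
    with i(3) show ?thesis using conv_mono unfolding released_def by blast
  qed
qed

definition adjacent :: "nat \<Rightarrow> nat \<Rightarrow> bool" where
  "adjacent a b \<longleftrightarrow> (\<exists>t. adj ev t a b)"

definition eventually_near :: "nat \<Rightarrow> nat list \<Rightarrow> bool" where
  "eventually_near a u \<longleftrightarrow> (\<exists>t. near ev t a u)"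

lemma eventually_near_iff: "eventually_near a u \<longleftrightarrow> prefix u (str a) \<or>
    strict_prefix (str a) u \<and> (witness ev a \<longrightarrow> (\<exists>t. released ev (label a) (str a) u t))"
  unfolding eventually_near_def near_def by blast

lemma adjacent_iff: "adjacent a b \<longleftrightarrow> eventually_near a (str b) \<and> eventually_near b (str a)"
proof
  assume "eventually_near a (str b) \<and> eventually_near b (str a)"
  then obtain t t' where "near ev t a (str b)" "near ev t' b (str a)"
    unfolding eventually_near_def by blast
  then have "near ev (max t t') a (str b)" "near ev (max t t') b (str a)"
    unfolding near_def using released_mono max.cobounded1 max.cobounded2 by blast+
  then show "adjacent a b" unfolding adjacent_def adj_def by blast
qed (auto simp: adjacent_def adj_def eventually_near_def)

lemma eventually_near_comparable: "eventually_near a u \<Longrightarrow> prefix u (str a) \<or> strict_prefix (str a) u"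
  unfolding eventually_near_iff by blast

lemma eventually_near_string_node: "eventually_near (string_node v) u \<longleftrightarrow> prefix u v \<or> prefix v u"
  unfolding eventually_near_iff by (auto simp: strict_prefix_def)

definition maximal_clique :: "nat set \<Rightarrow> bool" where
  "maximal_clique W \<longleftrightarrow> W \<noteq> {} \<and> (\<forall>a\<in>W. \<forall>b\<in>W. adjacent a b) \<and>
    (\<forall>a. (\<forall>b\<in>W. adjacent a b) \<longrightarrow> a \<in> W)"

lemma maximal_cliqueD:
  assumes "maximal_clique W"
  shows "W \<noteq> {}" "a \<in> W \<Longrightarrow> b \<in> W \<Longrightarrow> adjacent a b" "(\<And>b. b \<in> W \<Longrightarrow> adjacent a b) \<Longrightarrow> a \<in> W"
  using assms unfolding maximal_clique_def by blast+

text \<open>Whatever is joined to a node is joined to all prefixes of its string.\<close>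

lemma clique_prefix_closed:
  assumes W: "maximal_clique W" and a: "a \<in> W" and u: "prefix u (str a)"
  shows "string_node u \<in> W"
proof (rule maximal_cliqueD(3)[OF W])
  fix b
  assume "b \<in> W"
  then have ab: "eventually_near a (str b)" "eventually_near b (str a)"
    using maximal_cliqueD(2)[OF W a] unfolding adjacent_iff by blast+
  have "prefix u (str b) \<or> prefix (str b) u"
    using eventually_near_comparable[OF ab(2)] u
    by (metis prefix_order.trans prefix_same_cases strict_prefix_def)
  moreover have "eventually_near b u"
    using ab(2) unfolding eventually_near_iff[of b "str a"]
  proof
    assume "prefix (str a) (str b)"
    with u show ?thesis unfolding eventually_near_iff using prefix_order.trans by blast
  next
    assume *: "strict_prefix (str b) (str a) \<and>
      (witness ev b \<longrightarrow> (\<exists>t. released ev (label b) (str b) (str a) t))"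
    have "witness ev b \<longrightarrow> (\<exists>t. released ev (label b) (str b) u t)"
      using * released_prefix[OF _ u] by blast
    with \<open>prefix u (str b) \<or> prefix (str b) u\<close> show ?thesis
      unfolding eventually_near_iff by (auto simp: strict_prefix_def)
  qed
  ultimately show "adjacent (string_node u) b"
    by (auto simp: adjacent_iff eventually_near_string_node)
qed

lemma clique_comparable:
  assumes W: "maximal_clique W" and "a \<in> W" "b \<in> W"
  shows "prefix (str a) (str b) \<or> strict_prefix (str b) (str a)"
  using maximal_cliqueD(2)[OF W \<open>b \<in> W\<close> \<open>a \<in> W\<close>] eventually_near_comparable
  unfolding adjacent_iff by blast

lemma conv_uniform: "\<exists>T. \<forall>e\<le>n. (\<exists>t. conv ev e m t) \<longrightarrow> conv ev e m T"
proof (induction n)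
  case 0
  show ?case by auto
next
  case (Suc n)
  then obtain T where T: "\<And>e. e \<le> n \<Longrightarrow> \<exists>t. conv ev e m t \<Longrightarrow> conv ev e m T" by blast
  obtain T' where T': "\<exists>t. conv ev (Suc n) m t \<Longrightarrow> conv ev (Suc n) m T'" by blast
  have "conv ev e m (max T T')" if "e \<le> Suc n" "\<exists>t. conv ev e m t" for e
  proof (cases "e = Suc n")
    case True
    then show ?thesis using T' that conv_mono[of e m T' m "max T T'"] by simp
  next
    case False
    then show ?thesis using T that conv_mono[of e m T m "max T T'"] by simp
  qed
  then show ?case by blast
qed

text \<open>If \<open>v\<close> were the longest string, then \<open>v\<close> followed by a huge number \<open>T\<close> could be added to the clique: every
  witness node in the clique is joined to \<open>v\<close>, so it has released \<open>v\<close>, either by a step before the end of \<open>v\<close>, or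
  because its program converges up to the weight of \<open>v\<close>, and then the step to \<open>T\<close> outweighs that computation.\<close>

lemma clique_extends:
  assumes W: "maximal_clique W" and v: "string_node v \<in> W"
  shows "\<exists>u. strict_prefix v u \<and> string_node u \<in> W"
proof (rule ccontr)
  assume longest: "\<not> ?thesis"
  have below: "prefix (str a) v" if "a \<in> W" for a
  proof (rule ccontr)
    assume "\<not> prefix (str a) v"
    then have "strict_prefix v (str a)" using clique_comparable[OF W that v] by auto
    moreover have "string_node (str a) \<in> W" by (rule clique_prefix_closed[OF W that]) simp
    ultimately show False using longest by blast
  qed
  obtain T where T: "\<And>e t. e \<le> weight v \<Longrightarrow> conv ev e (weight v) t \<Longrightarrow> conv ev e (weight v) T"
    using conv_uniform[of "weight v" "weight v"] by blast
  let ?u = "v @ [T]"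
  have "string_node ?u \<in> W"
  proof (rule maximal_cliqueD(3)[OF W])
    fix a
    assume a: "a \<in> W"
    have "strict_prefix (str a) ?u"
      using below[OF a] by (metis prefix_order.le_less_trans prefix_snoc strict_prefix_def append_self_conv not_Cons_self2 prefix_def)
    moreover have "\<exists>t. released ev (label a) (str a) ?u t" if wit: "witness ev a"
    proof -
      let ?e = "label a"
      have e: "?e \<le> weight v"
        using wit weight_prefix[OF below[OF a]] unfolding witness_def by linarith
      have *: "released ev ?e (str a) ?u t" if "conv ev ?e (weight v) t'" for t t'
      proof -
        have "conv ev ?e (weight v) (weight ?u)"
          by (rule conv_mono[OF T[OF e that]]) (simp_all add: weight_def)
        then show ?thesis
          using prefix_length_le[OF below[OF a]] unfolding released_def
          by (intro disjI2 exI[of _ "length v"]) simp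
      qed
      have "eventually_near a v"
        using maximal_cliqueD(2)[OF W a v] unfolding adjacent_iff by simp
      then consider "str a = v" | t where "released ev ?e (str a) v t"
        unfolding eventually_near_iff using wit below[OF a] prefix_order.antisym by blast
      then show ?thesis
      proof cases
        case 1
        then show ?thesis using wit * unfolding witness_def by metis
      next
        case 2
        then show ?thesis unfolding released_def[of _ _ _ v]
        proof (elim disjE exE conjE)
          fix i
          assume "length (str a) \<le> i" "i < length v" "conv ev ?e (weight (take i v)) (weight (take (Suc i) v))"
          then show ?thesis unfolding released_def by (intro exI[of _ 0] disjI2 exI[of _ i]) simp
        qed (use * in blast)
      qed
    qed
    ultimately show "adjacent (string_node ?u) a"
      unfolding adjacent_iff eventually_near_string_node
      by (auto simp: eventually_near_iff strict_prefix_def)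
  qed
  moreover have "strict_prefix v ?u" by (simp add: strict_prefix_def)
  ultimately show False using longest by blast
qed

lemma clique_unbounded:
  assumes W: "maximal_clique W"
  shows "\<exists>u. string_node u \<in> W \<and> n \<le> length u"
proof (induction n)
  case 0
  obtain a where "a \<in> W" using maximal_cliqueD(1)[OF W] by blast
  then have "string_node (str a) \<in> W" by (rule clique_prefix_closed[OF W]) simp
  then show ?case by blast
next
  case (Suc n)
  then obtain u where u: "string_node u \<in> W" "n \<le> length u" by blast
  then obtain w where "strict_prefix u w" "string_node w \<in> W" using clique_extends[OF W] by blast
  moreover then have "length u < length w" by (simp add: prefix_length_less)
  ultimately show ?case using u(2) by (intro exI[of _ w]) simp
qed

lemma total_conv:
  assumes "computes {} e h"
  shows "\<exists>t. conv ev e m t"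
proof -
  obtain n where n: "\<And>k x. k \<ge> n \<Longrightarrow> x < Suc m \<Longrightarrow> ev k {} e x = Some (h x)"
    using computes_below[OF assms] by blast
  define t where "t = max n (Suc (Max (h ` {..m})))"
  have "h x < t" if "x \<le> m" for x
  proof -
    have "h x \<le> Max (h ` {..m})" using that by (intro Max_ge) auto
    then show ?thesis unfolding t_def by simp
  qed
  then have "conv ev e m t" unfolding conv_def using n[of t] by (auto simp: t_def)
  then show ?thesis by blast
qed

text \<open>A total program releases every string in the end, so nothing in the clique blocks its witness node.\<close>

lemma clique_contains_witness:
  assumes W: "maximal_clique W" and u: "string_node u \<in> W" and e: "computes {} e h" "e \<le> weight u"
  shows "\<exists>s. witness ev (witness_node e u s) \<and> witness_node e u s \<in> W"
proof -
  obtain s where s: "conv ev e (weight u) s" using total_conv[OF e(1)] by blast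
  let ?z = "witness_node e u s"
  have wit: "witness ev ?z" using s e(2) by simp
  have "?z \<in> W"
  proof (rule maximal_cliqueD(3)[OF W])
    fix b
    assume b: "b \<in> W"
    have near: "eventually_near b u" "prefix (str b) u \<or> prefix u (str b)"
      using maximal_cliqueD(2)[OF W u b] unfolding adjacent_iff eventually_near_string_node by simp_all
    have "\<exists>t. released ev e u (str b) t"
      using total_conv[OF e(1)] unfolding released_def by blast
    with near show "adjacent ?z b"
      unfolding adjacent_iff by (auto simp: eventually_near_iff[of ?z] strict_prefix_def)
  qed
  with wit show ?thesis by blast
qed

text \<open>Think of \<open>enum q j\<close> as "\<open>j\<close> has been enumerated by time \<open>q\<close>" and of \<open>f q\<close> as the time when a node \<open>c\<close> is found that has
  a string heavier than \<open>q\<close> and is seen to be joined to all nodes enumerated by time \<open>q\<close>.\<close>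

lemma maximal_clique_not_dominated:
  assumes W: "maximal_clique W"
    and f: "\<And>q. \<exists>c. c \<in> W \<and> q < weight (str c) \<and> weight (str c) \<le> f q \<and>
      (\<forall>j\<le>q. enum q j \<longrightarrow> adj ev (f q) j c)"
    and enum: "\<And>j. j \<in> W \<Longrightarrow> \<exists>q0. \<forall>q\<ge>q0. enum q j"
    and e: "computes {} e h" and dom: "\<And>q. f q \<le> h q"
  shows False
proof -
  have conv_less: "h x < t" if "conv ev e m t" "x \<le> m" for x m t
    using that computes_ev[OF e] unfolding conv_def by blast
  \<comment> \<open>A step this heavy would be found by \<open>f\<close> at the weight of \<open>p\<close>: every string in the clique heavier
    than \<open>p\<close> extends \<open>p @ [i]\<close>, so \<open>f\<close> would exceed \<open>h\<close> there.\<close>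
  have no_escape: "\<not> conv ev e (weight p) (weight (p @ [i]))" if p: "string_node (p @ [i]) \<in> W" for p i
  proof
    assume "conv ev e (weight p) (weight (p @ [i]))"
    then have "h (weight p) < weight (p @ [i])" by (rule conv_less) simp
    moreover obtain c where c: "c \<in> W" "weight p < weight (str c)" "weight (str c) \<le> f (weight p)"
      using f by blast
    have "prefix (p @ [i]) (str c)"
    proof (rule ccontr)
      assume "\<not> ?thesis"
      then have "strict_prefix (str c) (p @ [i])" using clique_comparable[OF W p c(1)] by simp
      then have "prefix (str c) p" by (auto simp: strict_prefix_def)
      then show False using weight_prefix c(2) by fastforce
    qed
    then have "weight (p @ [i]) \<le> h (weight p)"
      using weight_prefix c(3) dom[of "weight p"] by fastforce
    ultimately show False by simp
  qed
  obtain u where u: "string_node u \<in> W" "e \<le> length u" using clique_unbounded[OF W] by blast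
  then have "e \<le> weight u" by (simp add: weight_def)
  then obtain s where z: "witness ev (witness_node e u s)" "witness_node e u s \<in> W" (is "?z \<in> W")
    using clique_contains_witness[OF W u(1) e] by blast
  obtain q0 where q0: "\<And>q. q \<ge> q0 \<Longrightarrow> enum q ?z" using enum[OF z(2)] by blast
  \<comment> \<open>A string so long that the witness node has been enumerated by the time \<open>weight v\<close>.\<close>
  obtain v where v: "string_node v \<in> W" "Suc (length u + q0 + ?z) \<le> length v"
    using clique_unbounded[OF W] by blast
  have "strict_prefix u v"
    using clique_comparable[OF W u(1) v(1)] v(2)
    by (auto simp: strict_prefix_def dest: prefix_length_le)
  define q where "q = weight v"
  have q: "q0 \<le> q" "?z \<le> q" using v(2) unfolding q_def weight_def by linarith+
  obtain c where c: "c \<in> W" "q < weight (str c)" "weight (str c) \<le> f q"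
      "enum q ?z \<Longrightarrow> adj ev (f q) ?z c"
    using f[of q] q by blast
  have "prefix v (str c)"
    using clique_comparable[OF W v(1) c(1)] c(2) weight_strict_prefix unfolding q_def by fastforce
  with \<open>strict_prefix u v\<close> have uc: "strict_prefix u (str c)"
    using prefix_order.less_le_trans by blast
  have "near ev (f q) ?z (str c)" using c(4) q0[OF q(1)] unfolding adj_def by blast
  then have "released ev e u (str c) (f q)"
    unfolding near_def using z(1) uc prefix_order.less_le_not_le by auto
  then show False unfolding released_def
  proof (elim disjE exE conjE)
    assume "conv ev e (weight (str c)) (f q)"
    then have "h q < f q" using conv_less c(2) by simp
    then show False using dom[of q] by simp
  next
    fix i
    assume i: "i < length (str c)" "conv ev e (weight (take i (str c))) (weight (take (Suc i) (str c)))"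
    have "take (Suc i) (str c) = take i (str c) @ [str c ! i]" using i(1) by (rule take_Suc_conv_app_nth)
    moreover have "string_node (take (Suc i) (str c)) \<in> W"
      by (rule clique_prefix_closed[OF W c(1)]) (rule take_is_prefix)
    ultimately show False using no_escape i(2) by metis
  qed
qed

end

section \<open>The family has no maximal subfamily in the model\<close>

text \<open>Waits until the current stage exceeds all stages on which the answer depends.\<close>

definition family_op :: oper where
  "family_op k H X y =
    (if \<forall>a t b c. y = cpair a (2 * prod_encode (t, prod_encode (b, c)) + 1) \<longrightarrow>
        t \<le> k \<and> stage b \<le> k \<and> stage c \<le> k \<and> weight (str b) \<le> k \<and> weight (str c) \<le> k
     then Some (of_bool (y \<in> family H)) else None)"

text \<open>Program \<open>e\<close> decides a subfamily \<open>B\<close> from \<open>m\<close> columns; the node \<open>j\<close> has been enumerated by time \<open>q\<close> if its private element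
  \<open>2j\<close> is in one of the first \<open>q + 1\<close> sets of \<open>B\<close>. The answer is the stage of the first success.\<close>

fun search_op :: "nat \<times> nat \<Rightarrow> oper" where
  "search_op (m, e) k H X q =
    (if (\<forall>i\<le>q. \<forall>j\<le>q. H k (columns m X) e (cpair i (2 * j)) \<noteq> None) \<and>
        (\<forall>j\<le>q. stage j \<le> k \<and> weight (str j) \<le> k) \<and>
        (\<exists>c i. H k (columns m X) e (cpair i (2 * c)) = Some 1 \<and>
          stage c \<le> k \<and> q < weight (str c) \<and> weight (str c) \<le> k \<and>
          (\<forall>j\<le>q. (\<exists>i\<le>q. H k (columns m X) e (cpair i (2 * j)) = Some 1) \<longrightarrow> adj H k j c))
     then Some k else None)"

text \<open>The family \<open>B\<close> with \<open>A\<^sub>j\<close> put in front.\<close>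

definition graft :: "nat \<Rightarrow> nat set \<Rightarrow> nat set \<Rightarrow> nat set" where
  "graft j A B = {cpair 0 x | x. cpair j x \<in> A} \<union> {cpair (Suc i) x | i x. cpair i x \<in> B}"

definition uncpair :: "nat \<Rightarrow> nat \<times> nat" where
  "uncpair y = (SOME p. y = cpair (fst p) (snd p))"

fun graft_op :: "nat \<times> nat \<times> nat \<times> nat \<Rightarrow> oper" where
  "graft_op (j, d, m, e) k H X y =
    (if \<forall>i x. y \<noteq> cpair i x then Some 0
     else case uncpair y of
       (0, x) \<Rightarrow> H k {} d (cpair j x)
     | (Suc i, x) \<Rightarrow> H k (columns m X) e (cpair i x))"

lemma uncpair [simp]: "uncpair (cpair i x) = (i, x)"
proof -
  have "cpair i x = cpair (fst (uncpair (cpair i x))) (snd (uncpair (cpair i x)))"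
    unfolding uncpair_def by (rule someI[of _ "(i, x)"]) simp
  then show ?thesis by (simp add: prod_eq_iff)
qed

lemma cpair_in_graft [simp]:
  "cpair 0 x \<in> graft j A B \<longleftrightarrow> cpair j x \<in> A" "cpair (Suc i) x \<in> graft j A B \<longleftrightarrow> cpair i x \<in> B"
  by (auto simp: graft_def)

context machine
begin

lemma family_decidable:
  assumes "family_op \<in> range ops"
  shows "\<exists>d. \<forall>Y. decides Y d (family ev)"
proof -
  obtain d where d: "ops d = family_op" using assms by (metis rangeE)
  let ?ready = "\<lambda>k y. \<forall>a t b c. y = cpair a (2 * prod_encode (t, prod_encode (b, c)) + 1) \<longrightarrow>
        t \<le> k \<and> stage b \<le> k \<and> stage c \<le> k \<and> weight (str b) \<le> k \<and> weight (str c) \<le> k"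
  have family: "y \<in> family (history k ev) \<longleftrightarrow> y \<in> family ev" if ready: "?ready k y" for k y
  proof (cases "\<exists>a x. y = cpair a x")
    case False
    then show ?thesis by (auto simp: family_def)
  next
    case True
    then obtain a x where y: "y = cpair a x" by blast
    have "adj (history k ev) t b c \<longleftrightarrow> adj ev t b c"
      if "x = 2 * prod_encode (t, prod_encode (b, c)) + 1" for t b c
      by (rule adj_history) (use ready y that in blast)+
    then have "member (history k ev) a x \<longleftrightarrow> member ev a x"
      unfolding member_def by blast
    then show ?thesis by (simp add: y)
  qed
  have step: "step k Y d y = (if ?ready k y then Some (of_bool (y \<in> family ev)) else None)" for k Y y
    unfolding step_def d family_op_def by (rule if_cong[OF refl _ refl]) (simp only: family)
  have ready: "\<exists>k. ?ready k y" for y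
  proof (cases "\<exists>a t b c. y = cpair a (2 * prod_encode (t, prod_encode (b, c)) + 1)")
    case True
    then obtain a t b c where y: "y = cpair a (2 * prod_encode (t, prod_encode (b, c)) + 1)" by blast
    show ?thesis
      by (intro exI[of _ "t + stage b + stage c + weight (str b) + weight (str c)"]) (simp add: y)
  qed blast
  have "decides Y d (family ev)" for Y
  proof (rule computesI)
    show "v = of_bool (y \<in> family ev)" if "step k Y d y = Some v" for k y v
      using that unfolding step by (metis option.distinct(1) option.inject)
    show "\<exists>k. step k Y d y \<noteq> None" for y
      using ready[of y] unfolding step by (metis option.distinct(1))
  qed
  then show ?thesis by blast
qed

lemma graft_decidable:
  assumes ops: "range graft_op \<subseteq> range ops"
    and d: "decides {} d A" and e: "decides (columns m X) e B"
  shows "\<exists>i. decides (columns m X) i (graft j A B)"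
proof -
  obtain i where i: "ops i = graft_op (j, d, m, e)" using op_index[OF ops] by blast
  have B: "ev k (columns m (columns m X \<inter> {..<k})) e = ev k (columns m X) e" for k
    by (simp add: columns_Int columns_columns ev_Int)
  have step: "step k (columns m X) i y =
      (if \<forall>i x. y \<noteq> cpair i x then Some 0
       else case uncpair y of
         (0, x) \<Rightarrow> ev k {} d (cpair j x)
       | (Suc i, x) \<Rightarrow> ev k (columns m X) e (cpair i x))" for k y
    by (simp only: step_def i graft_op.simps history_le[OF order_refl] B)
  have is_pair: "\<not> (\<forall>i' x'. cpair l x \<noteq> cpair i' x')" for l x by blast
  have step_0: "step k (columns m X) i (cpair 0 x) = ev k {} d (cpair j x)" for k x
    unfolding step if_not_P[OF is_pair] by simp
  have step_Suc: "step k (columns m X) i (cpair (Suc l) x) = ev k (columns m X) e (cpair l x)" for k l x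
    unfolding step if_not_P[OF is_pair] by simp
  have "decides (columns m X) i (graft j A B)"
  proof (rule computesI)
    fix y k v
    assume v: "step k (columns m X) i y = Some v"
    consider x where "y = cpair 0 x" | l x where "y = cpair (Suc l) x" | "\<forall>i x. y \<noteq> cpair i x"
      by (metis not0_implies_Suc)
    then show "v = of_bool (y \<in> graft j A B)"
    proof cases
      case 1
      then show ?thesis using v computes_ev[OF d] by (simp add: step_0)
    next
      case 2
      then show ?thesis using v computes_ev[OF e] by (simp add: step_Suc)
    next
      case 3
      then have "v = 0" using v by (simp add: step)
      moreover have "y \<notin> graft j A B" using 3 by (auto simp: graft_def)
      ultimately show ?thesis by simp
    qed
  next
    fix y
    consider x where "y = cpair 0 x" | l x where "y = cpair (Suc l) x" | "\<forall>i x. y \<noteq> cpair i x"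
      by (metis not0_implies_Suc)
    then show "\<exists>k. step k (columns m X) i y \<noteq> None"
    proof cases
      case (1 x)
      obtain k where "ev k {} d (cpair j x) \<noteq> None" using d unfolding computes_def by blast
      then show ?thesis by (intro exI[of _ k]) (simp add: 1 step_0)
    next
      case (2 l x)
      obtain k where "ev k (columns m X) e (cpair l x) \<noteq> None" using e unfolding computes_def by blast
      then show ?thesis by (intro exI[of _ k]) (simp add: 2 step_Suc)
    next
      case 3
      then show ?thesis by (simp add: step)
    qed
  qed
  then show ?thesis by blast
qed

text \<open>Private elements tell which nodes occur in \<open>B\<close>, and distinct members of the family share exactly the
  elements that witness an edge. If a node is joined to all nodes of \<open>B\<close>, then its set can be grafted onto
  \<open>B\<close>, and maximality puts it into \<open>B\<close>.\<close>

lemma clique_of_maximal_subfamily: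
  assumes B: "sub B (family ev)" "d2 B"
    and max: "\<And>j. sub (graft j (family ev) B) (family ev) \<Longrightarrow> d2 (graft j (family ev) B) \<Longrightarrow>
      sub B (graft j (family ev) B) \<Longrightarrow> sub (graft j (family ev) B) B"
  shows "maximal_clique {j. \<exists>i. cpair i (2 * j) \<in> B}"
proof -
  obtain g where g: "\<And>i x. cpair i x \<in> B \<longleftrightarrow> member ev (g i) x"
    using B(1) unfolding sub_def cpair_in_family by metis
  have W: "{j. \<exists>i. cpair i (2 * j) \<in> B} = range g" by (auto simp: g)
  have refl: "adjacent a a" for a
    unfolding adjacent_iff eventually_near_iff by simp
  have common: "\<exists>x. member ev a x \<and> member ev b x" if "adjacent a b" for a b
    using that adj_member unfolding adjacent_def by blast
  have sym: "adjacent a b \<Longrightarrow> adjacent b a" for a b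
    unfolding adjacent_iff by blast
  have clique: "adjacent (g i) (g i')" for i i'
  proof (cases "g i = g i'")
    case False
    then have "\<not> (\<forall>x. cpair i x \<in> B \<longleftrightarrow> cpair i' x \<in> B)"
      unfolding g by (metis member_private)
    then obtain x where "member ev (g i) x" "member ev (g i') x"
      using B(2) unfolding d2_def g by blast
    with False show ?thesis unfolding adjacent_def by (intro member_both)
  qed (use refl in simp)
  have "a \<in> range g" if a: "\<And>i. adjacent a (g i)" for a
  proof -
    let ?C = "graft a (family ev) B"
    let ?g = "\<lambda>i. case i of 0 \<Rightarrow> a | Suc i \<Rightarrow> g i"
    have C: "cpair i x \<in> ?C \<longleftrightarrow> member ev (?g i) x" for i x
      by (cases i) (simp_all add: g)
    have "sub ?C (family ev)" unfolding sub_def cpair_in_family C by blast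
    moreover have "adjacent (?g i) (?g i')" for i i'
      using a sym clique refl by (simp split: nat.split)
    then have "d2 ?C" unfolding d2_def C using common by blast
    moreover have "sub B ?C" unfolding sub_def C g
    proof
      show "\<exists>j. \<forall>x. member ev (g i) x \<longleftrightarrow> member ev (?g j) x" for i
        by (rule exI[of _ "Suc i"]) simp
    qed
    ultimately have "sub ?C B" by (rule max)
    then obtain i where "\<forall>x. member ev (?g 0) x \<longleftrightarrow> member ev (g i) x"
      unfolding sub_def C g by blast
    then have "a = g i" by (metis member_private nat.case(1))
    then show ?thesis by blast
  qed
  with clique show ?thesis unfolding W maximal_clique_def by blast
qed

text \<open>The search succeeds at every \<open>q\<close>: the clique contains strings heavier than \<open>q\<close>, and all edges between such a
  string and the finitely many nodes enumerated by time \<open>q\<close> come up at some stage.\<close>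

lemma search_total:
  assumes ops: "range search_op \<subseteq> range ops" and e: "decides (columns m X) e B"
    and W: "maximal_clique {j. \<exists>i. cpair i (2 * j) \<in> B}"
  shows "\<exists>i f. computes X i f \<and> (\<forall>q. \<exists>c i. cpair i (2 * c) \<in> B \<and>
    q < weight (str c) \<and> weight (str c) \<le> f q \<and>
    (\<forall>j\<le>q. (\<exists>i\<le>q. cpair i (2 * j) \<in> B) \<longrightarrow> adj ev (f q) j c))"
proof -
  let ?W = "{j. \<exists>i. cpair i (2 * j) \<in> B}"
  let ?E = "\<lambda>k. ev k (columns m X) e"
  obtain p where p: "ops p = search_op (m, e)" using op_index[OF ops] by blast
  have E: "ev k (columns m (X \<inter> {..<k})) e = ?E k" for k
    by (simp add: columns_Int ev_Int)
  let ?found = "\<lambda>H k q c i. ?E k (cpair i (2 * c)) = Some 1 \<and>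
        stage c \<le> k \<and> q < weight (str c) \<and> weight (str c) \<le> k \<and>
        (\<forall>j\<le>q. (\<exists>i\<le>q. ?E k (cpair i (2 * j)) = Some 1) \<longrightarrow> adj H k j c)"
  let ?ready = "\<lambda>k q. (\<forall>i\<le>q. \<forall>j\<le>q. ?E k (cpair i (2 * j)) \<noteq> None) \<and>
        (\<forall>j\<le>q. stage j \<le> k \<and> weight (str j) \<le> k)"
  have "?found (history k ev) k q c i \<longleftrightarrow> ?found ev k q c i" if "?ready k q" for k q c i
    using that adj_history[of k k _ c ev] by blast
  then have step: "step k X p q = (if ?ready k q \<and> (\<exists>c i. ?found ev k q c i) then Some k else None)" for k q
    unfolding step_def p search_op.simps history_le[OF order_refl] E by (smt (verit))
  have dec: "?E k y = Some 1 \<Longrightarrow> y \<in> B" for k y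
    using computes_ev[OF e, of k y 1] by (cases "y \<in> B") auto
  have "\<exists>k. step k X p q \<noteq> None" for q
  proof -
    obtain u where u: "string_node u \<in> ?W" "Suc q \<le> length u"
      using clique_unbounded[OF W] by blast
    let ?c = "string_node u"
    obtain i where i: "cpair i (2 * ?c) \<in> B" using u(1) by blast
    have "finite ((\<lambda>(i, j). cpair i (2 * j)) ` ({..q} \<times> {..q}))" by simp
    then obtain N where N: "\<And>i j. i \<le> q \<Longrightarrow> j \<le> q \<Longrightarrow> cpair i (2 * j) < N"
      unfolding finite_nat_set_iff_bounded by auto
    obtain k0 where k0: "\<And>k y. k \<ge> k0 \<Longrightarrow> y < N + Suc (cpair i (2 * ?c)) \<Longrightarrow> ?E k y = Some (of_bool (y \<in> B))"
      using computes_below[OF e] by blast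
    have "\<exists>t. j \<in> ?W \<longrightarrow> adj ev t j ?c" for j
      using maximal_cliqueD(2)[OF W _ u(1)] unfolding adjacent_def by blast
    then obtain t where t: "\<And>j. j \<in> ?W \<Longrightarrow> adj ev (t j) j ?c" by metis
    \<comment> \<open>A stage at which all relevant values of \<open>B\<close> are computed and all relevant edges are present.\<close>
    define k where "k = k0 + stage ?c + weight (str ?c) + (\<Sum>j\<le>q. stage j + weight (str j) + t j)"
    have le: "stage j + weight (str j) + t j \<le> k" if "j \<le> q" for j
      using member_le_sum[of j "{..q}" "\<lambda>j. stage j + weight (str j) + t j"] that
      unfolding k_def by simp
    have val: "?E k (cpair i' (2 * j)) = Some (of_bool (cpair i' (2 * j) \<in> B))" if "i' \<le> q" "j \<le> q" for i' j
      by (rule k0) (use N[OF that] in \<open>simp_all add: k_def\<close>)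
    have "?ready k q" using val le by force
    moreover have "?found ev k q ?c i"
    proof (intro conjI allI impI)
      show "?E k (cpair i (2 * ?c)) = Some 1" using k0[of k "cpair i (2 * ?c)"] i by (simp add: k_def)
      show "q < weight (str ?c)" using u(2) by (simp add: weight_def)
      show "adj ev k j ?c" if "j \<le> q" and seen: "\<exists>i'\<le>q. ?E k (cpair i' (2 * j)) = Some 1" for j
      proof -
        have "j \<in> ?W" using seen dec by blast
        then show ?thesis using adj_mono[OF t] le[OF \<open>j \<le> q\<close>] by simp
      qed
    qed (simp_all add: k_def)
    ultimately show ?thesis unfolding step by (metis option.distinct(1))
  qed
  then have "\<exists>v n. ev n X p q = Some v" for q
    using step_converges by blast
  then obtain f where f: "\<And>q. \<exists>n. ev n X p q = Some (f q)" by metis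
  have "\<exists>c i. cpair i (2 * c) \<in> B \<and> q < weight (str c) \<and> weight (str c) \<le> f q \<and>
    (\<forall>j\<le>q. (\<exists>i\<le>q. cpair i (2 * j) \<in> B) \<longrightarrow> adj ev (f q) j c)" for q
  proof -
    obtain k where k: "step k X p q = Some (f q)" using f[of q] ev_from_step by blast
    then have "f q = k" and ready: "?ready k q" and "\<exists>c i. ?found ev k q c i"
      unfolding step by (metis option.distinct(1) option.inject)+
    then obtain c i where c: "?found ev k q c i" by blast
    have "?E k (cpair i' (2 * j)) = Some 1" if "i' \<le> q" "j \<le> q" "cpair i' (2 * j) \<in> B" for i' j
      using ready that computes_ev[OF e, of k "cpair i' (2 * j)"] by fastforce
    with c dec show ?thesis unfolding \<open>f q = k\<close> by blast
  qed
  with f show ?thesis unfolding computes_def by blast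
qed

text \<open>If \<open>B\<close> were maximal within \<open>sets_of X\<close>, its nodes would form a maximal clique, since grafts of \<open>B\<close> stay in
  \<open>sets_of X\<close>; then \<open>search_total\<close> yields a function computable from \<open>X\<close> that contradicts
  \<open>maximal_clique_not_dominated\<close>.\<close>

lemma no_maximal_subfamily:
  assumes ops: "family_op \<in> range ops" "range search_op \<subseteq> range ops" "range graft_op \<subseteq> range ops"
    and dom: "\<And>i f. computes X i f \<Longrightarrow> \<exists>e h. computes {} e h \<and> (\<forall>x. f x \<le> h x)"
    and B: "B \<in> sets_of X" "sub B (family ev)" "d2 B"
  shows "\<exists>C\<in>sets_of X. sub C (family ev) \<and> d2 C \<and> sub B C \<and> \<not> sub C B"
proof (rule ccontr)
  assume no: "\<not> ?thesis"
  obtain d where d: "\<And>Y. decides Y d (family ev)" using family_decidable[OF ops(1)] by blast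
  obtain m e where e: "decides (columns m X) e B" using B(1) unfolding sets_of_def by blast
  let ?W = "{j. \<exists>i. cpair i (2 * j) \<in> B}"
  have "graft j (family ev) B \<in> sets_of X" for j
    using graft_decidable[OF ops(3) d e] unfolding sets_of_def by blast
  then have W: "maximal_clique ?W"
    using no by (intro clique_of_maximal_subfamily B) blast
  obtain i f where "computes X i f" and f: "\<And>q. \<exists>c i. cpair i (2 * c) \<in> B \<and>
      q < weight (str c) \<and> weight (str c) \<le> f q \<and>
      (\<forall>j\<le>q. (\<exists>i\<le>q. cpair i (2 * j) \<in> B) \<longrightarrow> adj ev (f q) j c)"
    using search_total[OF ops(2) e W] by blast
  then obtain e' h where h: "computes {} e' h" "\<And>x. f x \<le> h x" using dom by blast
  show False
  proof (rule maximal_clique_not_dominated[OF W _ _ h, where enum = "\<lambda>q j. \<exists>i\<le>q. cpair i (2 * j) \<in> B"])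
    show "\<exists>q0. \<forall>q\<ge>q0. \<exists>i\<le>q. cpair i (2 * j) \<in> B" if "j \<in> ?W" for j
      using that by blast
  qed (use f in blast)
qed

end

text \<open>Biconditionals of the object language unfold into this form.\<close>

lemma mem_iff: "(x \<in> A \<longleftrightarrow> y \<in> B) \<longleftrightarrow> (x \<in> A \<longrightarrow> y \<in> B) \<and> (y \<in> B \<longrightarrow> x \<in> A)"
  by blast

lemma sat_subfamily: "sat M s S (subfamily B A) \<longleftrightarrow> sub (S B) (S A)"
  by (simp add: subfamily_def Let_def column_def sub_def mem_iff)

lemma sat_D2_intersection: "sat M s S (D2_intersection B) \<longleftrightarrow> d2 (S B)"
  by (simp add: D2_intersection_def Let_def column_def d2_def mem_iff)

lemma sat_nontrivial_family: "sat M s S (nontrivial_family A) \<longleftrightarrow> (\<exists>i x. cpair i x \<in> S A)"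
  by (simp add: nontrivial_family_def column_def)

lemma sat_D2IP:
  assumes "sat M s S D2IP" "A \<in> M" "cpair i x \<in> A"
  shows "\<exists>B\<in>M. sub B A \<and> d2 B \<and> (\<forall>C\<in>M. sub C A \<and> d2 C \<and> sub B C \<longrightarrow> sub C B)"
  using assms by (simp add: D2IP_def sat_subfamily sat_D2_intersection sat_nontrivial_family) blast

theorem corollary3p19: "\<not> (WKL0 \<turnstile> D2IP)"
proof
  assume provable: "WKL0 \<turnstile> D2IP"
  \<comment> \<open>Every program of the proof is available, and there are only countably many of them.\<close>
  define instructions where "instructions = range compr_op \<union> range path_op \<union> range bound_op \<union>
    {family_op} \<union> range search_op \<union> range graft_op"
  have "countable instructions" "instructions \<noteq> {}" unfolding instructions_def by simp_all
  define ops where "ops = from_nat_into instructions"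
  have ops: "range ops = instructions"
    unfolding ops_def by (rule range_from_nat_into) fact+
  interpret machine ops .
  obtain X where scott: "\<And>n. scott (ev n) n X"
    and dom: "\<And>i f. computes X i f \<Longrightarrow> \<exists>e h. computes {} e h \<and> (\<forall>x. f x \<le> h x)"
    using hyperimmune_free_basis unfolding ops instructions_def by blast
  let ?M = "sets_of X"
  have "valid ?M \<phi>" if "\<phi> \<in> WKL0" for \<phi>
  proof -
    have "valid ?M WKL"
      by (rule valid_WKL_sets_of) (use scott in \<open>auto simp: ops instructions_def\<close>)
    moreover have "valid ?M \<chi>" if "\<chi> \<in> Delta01_comprehension" for \<chi>
      by (rule valid_comprehension) (use that in \<open>auto simp: ops instructions_def\<close>)
    ultimately show ?thesis
      using that valid_semiring valid_induction unfolding WKL0_def RCA0_def by blast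
  qed
  with provable have D2IP: "valid ?M D2IP" by (rule soundness)
  have family: "family ev \<in> ?M"
    using family_decidable unfolding sets_of_def ops instructions_def by blast
  then have "sat ?M (\<lambda>_. 0) (\<lambda>_. family ev) D2IP"
    using D2IP unfolding valid_def by (simp add: image_subset_iff)
  moreover have "cpair 0 0 \<in> family ev" using member_private[of ev 0 0] by simp
  ultimately obtain B where B: "B \<in> ?M" "sub B (family ev)" "d2 B"
    and max: "\<forall>C\<in>?M. sub C (family ev) \<and> d2 C \<and> sub B C \<longrightarrow> sub C B"
    using sat_D2IP[OF _ family] by blast
  have "\<exists>C\<in>?M. sub C (family ev) \<and> d2 C \<and> sub B C \<and> \<not> sub C B"
    by (rule no_maximal_subfamily[OF _ _ _ dom B]) (auto simp: ops instructions_def)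
  with max show False by blast
qed

end
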